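(* Let $\Phi:\mathbb{S}^1\to\mathbb{R}^{+}$ be a smooth even function. Then there exists a family of smooth convex bodies $\{K_n\}_{n\in\mathbb{N}}\subset\mathcal{K}_{sym}$, with support functions $s_n$ and boundary curvatures $\kappa_n$, such that $$\lim_{n\to\infty}\ \sup_{\mathbb{S}^1}\left|\frac{s_n}{\kappa_n^{1/3}}-\Phi\right|=0 .$$ Furthermore, if $\Phi$ is $\frac{\pi}{k}$-periodic for some integer $k\ge 2$, this family of convex bodies is uniformly bounded and converges in the $C^{\infty}$ norm to a smooth convex body whose support function $s$ satisfies $s\,(s_{\theta\theta}+s)^{1/3}=\Phi$ on $\mathbb{S}^1$.
   Context: Functions on $\mathbb{S}^1$ are identified with $2\pi$-periodic functions of the angle $\theta$, via $z=(\cos\theta,\sin\theta)$. A function $\Phi$ on $\mathbb{S}^1$ is even if $\Phi(\theta+\pi)=\Phi(\theta)$ for all $\theta$. $\mathcal{K}_{sym}$ denotes the set of compact, strictly convex bodies in $\mathbb{R}^2$ that are symmetric about the origin and have smooth boundary (with positive curvature). For $K\in\mathcal{K}_{sym}$, $s(\theta)=\max_{y\in K}\langle y,(\cos\theta,\sin\theta)\rangle$ is the support function, and $\kappa$ is the curvature of $\partial K$, regarded as a function of the angle $\theta$ of the outer unit normal, so that $1/\kappa=s_{\theta\theta}+s$. *)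

theory Defs
  imports "HOL-Analysis.Analysis"
begin

definition smooth :: "(real \<Rightarrow> real) \<Rightarrow> bool" where
  "smooth f \<longleftrightarrow> (\<forall>m x. (deriv ^^ m) f differentiable (at x))"

definition dir :: "real \<Rightarrow> real ^ 2" where
  "dir \<theta> = vector [cos \<theta>, sin \<theta>]"

definition support_fn :: "(real ^ 2) set \<Rightarrow> real \<Rightarrow> real" where
  "support_fn K \<theta> = (SUP y\<in>K. y \<bullet> dir \<theta>)"

definition strictly_convex :: "(real ^ 2) set \<Rightarrow> bool" where
  "strictly_convex K \<longleftrightarrow> (\<forall>x\<in>K. \<forall>y\<in>K. x \<noteq> y \<longrightarrow> open_segment x y \<subseteq> interior K)"

text \<open>A regular smooth simple closed curve that traces out the boundary of \<open>K\<close>.\<close>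

definition boundary_param :: "(real ^ 2) set \<Rightarrow> (real \<Rightarrow> real ^ 2) \<Rightarrow> bool" where
  "boundary_param K \<gamma> \<longleftrightarrow>
     (\<forall>i. smooth (\<lambda>t. \<gamma> t $ i)) \<and>
     (\<forall>t. \<gamma> (t + 2 * pi) = \<gamma> t) \<and>
     inj_on \<gamma> {0..<2 * pi} \<and>
     (\<forall>t. \<exists>i. deriv (\<lambda>t. \<gamma> t $ i) t \<noteq> 0) \<and>
     range \<gamma> = frontier K"

text \<open>The absolute value makes this independent of the orientation of \<open>\<gamma>\<close>. On the boundary of a
  convex body it is the curvature with respect to the inner normal.\<close>

definition curve_curvature :: "(real \<Rightarrow> real ^ 2) \<Rightarrow> real \<Rightarrow> real" where
  "curve_curvature \<gamma> t =
     (let x = (\<lambda>t. \<gamma> t $ 1); y = (\<lambda>t. \<gamma> t $ 2) in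
        \<bar>deriv x t * (deriv ^^ 2) y t - deriv y t * (deriv ^^ 2) x t\<bar>
          / sqrt ((deriv x t)\<^sup>2 + (deriv y t)\<^sup>2) ^ 3)"

definition K_sym :: "(real ^ 2) set set" where
  "K_sym = {K. compact K \<and> convex K \<and> interior K \<noteq> {} \<and> strictly_convex K \<and> uminus ` K = K \<and>
               (\<exists>\<gamma>. boundary_param K \<gamma> \<and> (\<forall>t. curve_curvature \<gamma> t > 0))}"

text \<open>The curvature of the boundary of \<open>K\<close> at the point with outer unit normal \<open>dir \<theta>\<close>. A boundary
  point \<open>p\<close> has \<open>dir \<theta>\<close> as an outer normal iff \<open>p \<bullet> dir \<theta> = support_fn K \<theta>\<close>; for \<open>K \<in> K_sym\<close> this
  determines \<open>p\<close> by strict convexity, and the curvature at \<open>p\<close> does not depend on the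
  parametrization, so the description is unique.\<close>

definition boundary_curvature :: "(real ^ 2) set \<Rightarrow> real \<Rightarrow> real" where
  "boundary_curvature K \<theta> =
     (THE c. \<exists>\<gamma> t. boundary_param K \<gamma> \<and> \<gamma> t \<bullet> dir \<theta> = support_fn K \<theta> \<and> c = curve_curvature \<gamma> t)"

text \<open>Convergence of convex bodies in the \<open>C\<^sup>\<infinity>\<close> topology is that of their support functions:
  uniform convergence of the derivatives of every order.\<close>

definition Cinf_converges :: "(nat \<Rightarrow> (real ^ 2) set) \<Rightarrow> (real ^ 2) set \<Rightarrow> bool" where
  "Cinf_converges K L \<longleftrightarrow>
     (\<forall>m. uniform_limit UNIV (\<lambda>n. (deriv ^^ m) (support_fn (K n))) ((deriv ^^ m) (support_fn L))
            sequentially)"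

end

theory Submission
  imports Defs
begin

text \<open>
  For \<open>f = \<Phi>\<^sup>3\<close> the equation \<open>s (s'' + s)\<^sup>1\<^sup>/\<^sup>3 = \<Phi>\<close> reads \<open>s\<^sup>3 (s'' + s) = f\<close>.  Every smooth positive
  \<open>\<pi>\<close>-periodic function \<open>s\<close> with \<open>s'' + s > 0\<close> is the support function of a body in \<open>K_sym\<close> whose
  boundary curvature is \<open>1 / (s'' + s)\<close> (\<open>exists_body_with_support\<close>).  Both claims thus become claims
  about functions on the circle.

  Approximate solutions come from thin ellipses (\<open>even_support_approximation\<close>).  The support function
  \<open>q\<^sub>b = sqrt (sin\<^sup>2 + b\<^sup>2 cos\<^sup>2)\<close> of an ellipse satisfies \<open>q\<^sub>b\<^sup>3 (q\<^sub>b'' + q\<^sub>b) = b\<^sup>2\<close>, so a multiple of it solves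
  the equation for the constant right hand side \<open>f 0\<close>.  To reach \<open>f\<close> one adds a small multiple of the
  periodic solution \<open>w\<close> of \<open>w'' + w = (f - f 0) / q\<^sub>d\<^sup>3\<close> with a fixed small \<open>d\<close>.  As \<open>b\<close> tends to \<open>0\<close>, this
  correction becomes negligible against the ellipse, even in the direction \<open>0\<close> where the ellipse is thin,
  but it still changes \<open>s'' + s\<close> by the right relative amount:  up to a factor that tends to \<open>1\<close> uniformly,
  \<open>s\<^sup>3 (s'' + s)\<close> is \<open>f 0 + (f - f 0) (q\<^sub>b / q\<^sub>d)\<^sup>3\<close>.  This is uniformly close to \<open>f\<close> if \<open>b \<le> d\<close> and \<open>d\<close> is small,
  because \<open>q\<^sub>b / q\<^sub>d\<close> is close to \<open>1\<close> except near the zeros of the sine, and there \<open>f - f 0\<close> is small.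

  If \<open>f\<close> has the period \<open>T = \<pi> / k\<close> with \<open>k \<ge> 2\<close>, there is an exact solution
  (\<open>even_support_of_periodic\<close>), and the constant sequence of its body has all the required properties.
  On \<open>T\<close>-periodic functions the operator \<open>s \<mapsto> s'' + s\<close> is inverted by the convolution \<open>G\<close> with a kernel
  whose values all lie between \<open>cos (T / 2)\<close> and \<open>1\<close>, up to a common factor.  For \<open>u = ln s\<close> the equation
  becomes \<open>u = ln (G (f exp (- 3 u)))\<close>.  Averaging with such a kernel shrinks the oscillation of
  logarithms of positive functions by the factor \<open>1 - cos (T / 2)\<close>, a Doeblin type estimate
  (\<open>green_ln_oscillation\<close>), and the exponent costs a factor \<open>3\<close>.  Since \<open>cos (T / 2) \<ge> 1 / sqrt 2\<close>, the
  product \<open>3 (1 - cos (T / 2))\<close> is below \<open>1\<close>.  So there is a fixed point up to an additive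
  constant, and the constant is adjusted by rescaling \<open>s\<close>, because the right hand side
  \<open>G (f / s\<^sup>3)\<close> is homogeneous of degree \<open>-3\<close> in \<open>s\<close>.
\<close>

section \<open>Smooth functions of a real variable\<close>

text \<open>
  Closure properties of smooth functions are proved order by order:  the derivative of a product, an
  inverse or a square root is a sum of products of functions already known to be differentiable to one
  order less.  A predicate for finite order makes this an induction.
\<close>

definition differentiable_upto :: "nat \<Rightarrow> (real \<Rightarrow> real) \<Rightarrow> bool" where
  "differentiable_upto n f \<longleftrightarrow> (\<forall>m\<le>n. \<forall>x. (deriv ^^ m) f differentiable (at x))"

lemma smooth_iff_differentiable_upto: "smooth f \<longleftrightarrow> (\<forall>n. differentiable_upto n f)"
  unfolding smooth_def differentiable_upto_def by blast

lemma differentiable_upto_0: "differentiable_upto 0 f \<longleftrightarrow> (\<forall>x. f differentiable (at x))"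
  by (simp add: differentiable_upto_def)

lemma differentiable_upto_Suc:
  "differentiable_upto (Suc n) f \<longleftrightarrow>
     (\<forall>x. f differentiable (at x)) \<and> differentiable_upto n (deriv f)"
proof -
  have "(\<forall>m\<le>Suc n. P m) \<longleftrightarrow> P 0 \<and> (\<forall>m\<le>n. P (Suc m))" for P
    by (metis Suc_le_mono le0 not0_implies_Suc)
  then show ?thesis
    unfolding differentiable_upto_def by (simp add: funpow_Suc_right del: funpow.simps(2))
qed

lemma DERIV_deriv_of_differentiable:
  fixes f :: "real \<Rightarrow> real"
  shows "f differentiable (at x) \<Longrightarrow> (f has_real_derivative deriv f x) (at x)"
  using DERIV_deriv_iff_real_differentiable by blast

lemma differentiable_upto_SucI:
  assumes "\<And>x. (f has_real_derivative f' x) (at x)" "differentiable_upto n f'"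
  shows "differentiable_upto (Suc n) f"
proof -
  have "deriv f = f'" using assms(1) by (auto intro: DERIV_imp_deriv)
  then show ?thesis
    using assms by (auto simp: differentiable_upto_Suc real_differentiable_def)
qed

lemma differentiable_upto_DERIV:
  assumes "differentiable_upto n f"
  shows "(f has_real_derivative deriv f x) (at x)"
  using assms by (cases n)
    (auto simp: differentiable_upto_0 differentiable_upto_Suc intro: DERIV_deriv_of_differentiable)

lemma differentiable_upto_Suc_imp:
  assumes "differentiable_upto (Suc n) f"
  shows "differentiable_upto n f" "differentiable_upto n (deriv f)"
  using assms by (simp add: differentiable_upto_def) (simp add: assms[unfolded differentiable_upto_Suc])

lemma differentiable_upto_const: "differentiable_upto n (\<lambda>x. c)"
proof (induction n arbitrary: c)
  case (Suc n)
  show ?case by (rule differentiable_upto_SucI[OF _ Suc[of 0]]) (auto intro!: derivative_eq_intros)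
qed (simp add: differentiable_upto_0)

lemma differentiable_upto_add:
  "differentiable_upto n f \<Longrightarrow> differentiable_upto n g \<Longrightarrow> differentiable_upto n (\<lambda>x. f x + g x)"
proof (induction n arbitrary: f g)
  case (Suc n)
  show ?case
    by (rule differentiable_upto_SucI[OF DERIV_add])
      (use Suc in \<open>auto intro: differentiable_upto_DERIV differentiable_upto_Suc_imp\<close>)
qed (simp add: differentiable_upto_0)

lemma differentiable_upto_mult:
  "differentiable_upto n f \<Longrightarrow> differentiable_upto n g \<Longrightarrow> differentiable_upto n (\<lambda>x. f x * g x)"
proof (induction n arbitrary: f g)
  case (Suc n)
  show ?case
    by (rule differentiable_upto_SucI[OF DERIV_mult])
      (use Suc in \<open>auto intro!: differentiable_upto_add Suc.IH
        intro: differentiable_upto_DERIV differentiable_upto_Suc_imp\<close>)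
qed (simp add: differentiable_upto_0)

lemma differentiable_upto_inverse:
  "differentiable_upto n f \<Longrightarrow> (\<And>x. f x \<noteq> 0) \<Longrightarrow> differentiable_upto n (\<lambda>x. inverse (f x))"
proof (induction n)
  case (Suc n)
  have *: "((\<lambda>x. inverse (f x)) has_real_derivative
      (- 1) * (deriv f x * (inverse (f x) * inverse (f x)))) (at x)" for x
    using differentiable_upto_DERIV[OF Suc.prems(1)] Suc.prems(2)
    by (auto intro!: derivative_eq_intros simp: field_simps)
  have n: "differentiable_upto n f" "differentiable_upto n (deriv f)"
    using differentiable_upto_Suc_imp[OF Suc.prems(1)] by auto
  show ?case
    by (intro differentiable_upto_SucI[OF *] differentiable_upto_mult differentiable_upto_const
        Suc.IH n Suc.prems(2))
qed (simp add: differentiable_upto_0)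

lemma DERIV_sqrt_compose:
  assumes "(f has_real_derivative f') (at x)" "f x > 0"
  shows "((\<lambda>x. sqrt (f x)) has_real_derivative f' * (inverse (sqrt (f x)) * (1/2))) (at x)"
  using DERIV_chain2[OF DERIV_real_sqrt[OF assms(2)] assms(1)] by (simp add: mult.commute)

lemma differentiable_upto_sqrt:
  "differentiable_upto n f \<Longrightarrow> (\<And>x. f x > 0) \<Longrightarrow> differentiable_upto n (\<lambda>x. sqrt (f x))"
proof (induction n)
  case 0
  then show ?case
    using DERIV_sqrt_compose[OF differentiable_upto_DERIV[OF 0(1)] 0(2)]
    by (auto simp: differentiable_upto_0 real_differentiable_def)
next
  case (Suc n)
  have n: "differentiable_upto n f" "differentiable_upto n (deriv f)"
    using differentiable_upto_Suc_imp[OF Suc.prems(1)] by auto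
  have "sqrt (f x) \<noteq> 0" for x using Suc.prems(2)[of x] by simp
  then show ?case
    by (intro differentiable_upto_SucI[OF DERIV_sqrt_compose[OF differentiable_upto_DERIV[of n f]]]
        differentiable_upto_mult differentiable_upto_const differentiable_upto_inverse Suc n)
qed

lemma differentiable_upto_sin_cos:
  "differentiable_upto n (\<lambda>x. sin x) \<and> differentiable_upto n (\<lambda>x. cos x)"
proof (induction n)
  case 0
  show ?case
    by (auto simp: differentiable_upto_0 real_differentiable_def intro!: DERIV_sin DERIV_cos)
next
  case (Suc n)
  have c: "differentiable_upto n (\<lambda>x. (-1) * sin x)"
    using Suc by (intro differentiable_upto_mult differentiable_upto_const) auto
  show ?case
  proof
    show "differentiable_upto (Suc n) (\<lambda>x. sin x)"
      by (rule differentiable_upto_SucI[OF DERIV_sin]) (use Suc in auto)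
    show "differentiable_upto (Suc n) (\<lambda>x. cos x)"
      by (rule differentiable_upto_SucI[OF _ c]) (auto intro!: derivative_eq_intros)
  qed
qed

named_theorems smooth_intros

lemma smooth_const [smooth_intros]: "smooth (\<lambda>x. c)"
  by (simp add: smooth_iff_differentiable_upto differentiable_upto_const)
lemma smooth_sin [smooth_intros]: "smooth (\<lambda>x. sin x)"
  by (simp add: smooth_iff_differentiable_upto differentiable_upto_sin_cos)
lemma smooth_cos [smooth_intros]: "smooth (\<lambda>x. cos x)"
  by (simp add: smooth_iff_differentiable_upto differentiable_upto_sin_cos)
lemma smooth_add [smooth_intros]: "smooth f \<Longrightarrow> smooth g \<Longrightarrow> smooth (\<lambda>x. f x + g x)"
  by (simp add: smooth_iff_differentiable_upto differentiable_upto_add)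
lemma smooth_mult [smooth_intros]: "smooth f \<Longrightarrow> smooth g \<Longrightarrow> smooth (\<lambda>x. f x * g x)"
  by (simp add: smooth_iff_differentiable_upto differentiable_upto_mult)
lemma smooth_diff [smooth_intros]: "smooth f \<Longrightarrow> smooth g \<Longrightarrow> smooth (\<lambda>x. f x - g x)"
  using smooth_add[OF _ smooth_mult[OF smooth_const[of "-1"]], of f g] by simp
lemma smooth_power [smooth_intros]: "smooth f \<Longrightarrow> smooth (\<lambda>x. f x ^ n)"
  by (induction n) (auto intro: smooth_intros)
lemma smooth_sqrt [smooth_intros]: "smooth f \<Longrightarrow> (\<And>x. f x > 0) \<Longrightarrow> smooth (\<lambda>x. sqrt (f x))"
  by (simp add: smooth_iff_differentiable_upto differentiable_upto_sqrt)
lemma smooth_divide [smooth_intros]: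
  "smooth f \<Longrightarrow> smooth g \<Longrightarrow> (\<And>x. g x \<noteq> 0) \<Longrightarrow> smooth (\<lambda>x. f x / g x)"
  unfolding divide_inverse
  by (simp add: smooth_iff_differentiable_upto differentiable_upto_mult differentiable_upto_inverse)

lemma smooth_DERIV: "smooth f \<Longrightarrow> (f has_real_derivative deriv f x) (at x)"
  using differentiable_upto_DERIV smooth_iff_differentiable_upto by blast

lemma smooth_deriv [smooth_intros]: "smooth f \<Longrightarrow> smooth (deriv f)"
  using differentiable_upto_Suc_imp(2) smooth_iff_differentiable_upto by blast

lemma smooth_continuous_on: "smooth f \<Longrightarrow> continuous_on A f"
  by (meson DERIV_continuous_on smooth_DERIV has_field_derivative_at_within)

lemma funpow_2_deriv: "(deriv ^^ 2) f = deriv (deriv f)"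
  by (simp add: numeral_2_eq_2)

section \<open>Periodic functions\<close>

lemma periodic_int_shift:
  fixes g :: "real \<Rightarrow> 'a"
  assumes "\<And>x. g (x + T) = g x"
  shows "g (x + real_of_int n * T) = g x"
proof -
  interpret periodic_fun_simple g T by unfold_locales (rule assms)
  show ?thesis by (rule plus_of_int)
qed

lemma periodic_reduce:
  fixes T :: real
  assumes "T > 0"
  shows "\<exists>n. x + real_of_int n * T \<in> {a..a+T}"
proof -
  let ?y = "(x - a) / T"
  have "of_int \<lfloor>?y\<rfloor> * T \<le> ?y * T" "?y * T \<le> (of_int \<lfloor>?y\<rfloor> + 1) * T"
    using assms by (intro mult_right_mono; linarith)+
  then have "of_int \<lfloor>?y\<rfloor> * T \<le> x - a" "x - a \<le> of_int \<lfloor>?y\<rfloor> * T + T"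
    using assms by (auto simp: distrib_right)
  then show ?thesis by (intro exI[of _ "- \<lfloor>?y\<rfloor>"]) auto
qed

lemma periodic_attains_inf:
  fixes g :: "real \<Rightarrow> real"
  assumes "continuous_on UNIV g" "\<And>x. g (x + T) = g x" "T > 0"
  shows "\<exists>x0. \<forall>x. g x0 \<le> g x"
proof -
  have "continuous_on {0..0+T} g" using assms(1) continuous_on_subset by blast
  then obtain x0 where x0: "\<forall>y\<in>{0..0+T}. g x0 \<le> g y"
    using continuous_attains_inf[of "{0..0+T}" g] assms(3) by auto
  have "g x0 \<le> g x" for x
  proof -
    obtain n where n: "x + of_int n * T \<in> {0..0+T}" using periodic_reduce[OF assms(3)] by blast
    have "g (x + of_int n * T) = g x" by (rule periodic_int_shift) (rule assms(2))
    then show ?thesis using x0 n by metis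
  qed
  then show ?thesis by blast
qed

lemma periodic_bounded:
  fixes g :: "real \<Rightarrow> real"
  assumes "continuous_on UNIV g" "\<And>x. g (x + T) = g x" "T > 0"
  shows "\<exists>B>0. \<forall>x. \<bar>g x\<bar> \<le> B"
proof -
  obtain a where a: "\<forall>x. g a \<le> g x" using periodic_attains_inf[of g T] assms by blast
  obtain b where b: "\<forall>x. - g b \<le> - g x"
    using periodic_attains_inf[of "\<lambda>x. - g x" T] assms by (auto intro: continuous_on_minus)
  have "\<bar>g x\<bar> \<le> \<bar>g a\<bar> + \<bar>g b\<bar> + 1" for x using spec[OF a, of x] spec[OF b, of x] by linarith
  then show ?thesis by (intro exI[of _ "\<bar>g a\<bar> + \<bar>g b\<bar> + 1"]) simp
qed

lemma deriv_periodic: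
  fixes g :: "real \<Rightarrow> real"
  assumes "\<And>x. g (x + T) = g x"
  shows "deriv g (x + T) = deriv g x"
proof -
  have "(g has_real_derivative D) (at (x + T)) \<longleftrightarrow> (g has_real_derivative D) (at x)" for D
    using DERIV_shift[of g D x T] assms by simp
  then show ?thesis unfolding deriv_def by simp
qed

section \<open>The convex body with a given support function\<close>

lemma inner_dir: "y \<bullet> dir \<theta> = y $ 1 * cos \<theta> + y $ 2 * sin \<theta>"
  by (simp add: dir_def inner_vec_def sum_2)

lemma sin_cos_decompose: "a * cos \<theta> * cos \<theta> + a * sin \<theta> * sin \<theta> = (a :: real)"
  using sin_cos_squared_add3[of \<theta>] by (metis distrib_left mult.assoc mult.right_neutral)

lemma norm_dir: "norm (dir \<theta>) = 1"
  by (simp add: norm_eq_sqrt_inner inner_dir) (simp add: dir_def flip: power2_eq_square)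

text \<open>
  Second order contact is all that the comparison of two parametrizations of one curve needs, so the
  curvature is read off from this limit.
\<close>

lemma second_difference_quotient:
  fixes f :: "real \<Rightarrow> real"
  assumes f: "\<And>x. (f has_real_derivative f' x) (at x)"
    and f': "(f' has_real_derivative c) (at a)" and "f' a = 0"
  shows "((\<lambda>x. (f x - f a) / (x - a)\<^sup>2) \<longlongrightarrow> c / 2) (at a)"
proof (rule lhopital)
  have "isCont f a" using f DERIV_isCont by blast
  then have "((\<lambda>x. f x - f a) \<longlongrightarrow> f a - f a) (at a)"
    by (intro tendsto_intros) (simp add: isCont_def)
  then show "((\<lambda>x. f x - f a) \<longlongrightarrow> 0) (at a)" by simp
  have "((\<lambda>x. (x - a)\<^sup>2) \<longlongrightarrow> (a - a)\<^sup>2) (at a)" by (intro tendsto_intros)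
  then show "((\<lambda>x. (x - a)\<^sup>2) \<longlongrightarrow> 0) (at a)" by simp
  show "\<forall>\<^sub>F x in at a. (x - a)\<^sup>2 \<noteq> 0" by (auto simp: eventually_at_filter)
  show "\<forall>\<^sub>F x in at a. 2 * (x - a) \<noteq> 0" by (auto simp: eventually_at_filter)
  show "\<forall>\<^sub>F x in at a. ((\<lambda>x. f x - f a) has_real_derivative f' x) (at x)"
    using f by (auto intro!: always_eventually derivative_eq_intros)
  show "\<forall>\<^sub>F x in at a. ((\<lambda>x. (x - a)\<^sup>2) has_real_derivative 2 * (x - a)) (at x)"
    by (auto intro!: always_eventually derivative_eq_intros)
  have "((\<lambda>x. (f' x - f' a) / (x - a)) \<longlongrightarrow> c) (at a)"
    using f' by (simp add: has_field_derivative_iff)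
  then have "((\<lambda>x. (f' x - f' a) / (x - a) / 2) \<longlongrightarrow> c / 2) (at a)"
    by (intro tendsto_intros) auto
  then show "((\<lambda>x. f' x / (2 * (x - a))) \<longlongrightarrow> c / 2) (at a)"
    using \<open>f' a = 0\<close> by (simp add: field_simps)
qed

locale even_support =
  fixes s :: "real \<Rightarrow> real"
  assumes smooth_s: "smooth s"
    and s_pos: "\<And>\<theta>. s \<theta> > 0"
    and s_even: "\<And>\<theta>. s (\<theta> + pi) = s \<theta>"
    and radius_pos': "\<And>\<theta>. (deriv ^^ 2) s \<theta> + s \<theta> > 0"
begin

text \<open>
  The radius of curvature at the boundary point with outer normal \<open>dir \<theta>\<close>.
\<close>

definition radius :: "real \<Rightarrow> real" where
  "radius \<theta> = deriv (deriv s) \<theta> + s \<theta>"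

text \<open>
  With \<open>e = dir \<theta>\<close> and its derivative \<open>e'\<close> this is \<open>s e + s' e'\<close>, the inverse of the Gauss map.
\<close>

definition contact :: "real \<Rightarrow> real ^ 2" where
  "contact \<theta> = vector [s \<theta> * cos \<theta> - deriv s \<theta> * sin \<theta>, s \<theta> * sin \<theta> + deriv s \<theta> * cos \<theta>]"

definition body :: "(real ^ 2) set" where
  "body = {y. \<forall>\<theta>. y \<bullet> dir \<theta> \<le> s \<theta>}"

lemma radius_pos: "radius \<theta> > 0"
  using radius_pos'[of \<theta>] by (simp add: radius_def funpow_2_deriv)

lemma s_periodic: "s (\<theta> + 2 * pi) = s \<theta>"
  using s_even[of \<theta>] s_even[of "\<theta> + pi"] by (simp add: algebra_simps)

lemma DERIV_s: "(s has_real_derivative deriv s \<theta>) (at \<theta>)"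
  "(deriv s has_real_derivative (radius \<theta> - s \<theta>)) (at \<theta>)"
  using smooth_DERIV[OF smooth_s] smooth_DERIV[OF smooth_deriv[OF smooth_s]]
  by (auto simp: radius_def)

lemma smooth_radius: "smooth radius"
  unfolding radius_def by (intro smooth_intros smooth_s)

lemma contact_nth:
  "contact \<theta> $ 1 = s \<theta> * cos \<theta> - deriv s \<theta> * sin \<theta>"
  "contact \<theta> $ 2 = s \<theta> * sin \<theta> + deriv s \<theta> * cos \<theta>"
  by (simp_all add: contact_def)

lemma contact_periodic: "contact (\<theta> + 2 * pi) = contact \<theta>"
  using deriv_periodic[of s "2 * pi", OF s_periodic] by (simp add: contact_def s_periodic)

lemma contact_inner_self: "contact \<theta> \<bullet> dir \<theta> = s \<theta>"
  using sin_cos_decompose[of "s \<theta>" \<theta>] by (simp add: inner_dir contact_nth algebra_simps)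

lemma DERIV_contact:
  "((\<lambda>\<phi>. contact \<phi> $ 1) has_real_derivative - radius \<phi> * sin \<phi>) (at \<phi>)"
  "((\<lambda>\<phi>. contact \<phi> $ 2) has_real_derivative radius \<phi> * cos \<phi>) (at \<phi>)"
  unfolding contact_nth by (auto intro!: derivative_eq_intros DERIV_s simp: algebra_simps)

lemma DERIV_contact_inner:
  "((\<lambda>\<phi>. contact \<phi> \<bullet> dir \<theta>) has_real_derivative radius \<phi> * sin (\<theta> - \<phi>)) (at \<phi>)"
  unfolding inner_dir
  by (auto intro!: derivative_eq_intros DERIV_contact simp: sin_diff algebra_simps)

lemma radius_lower_bound: "\<exists>m>0. \<forall>\<theta>. m \<le> radius \<theta>"
proof -
  have "radius (\<theta> + pi) = radius \<theta>" for \<theta>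
    using deriv_periodic[of "deriv s" pi, OF deriv_periodic[of s, OF s_even]]
    by (simp add: radius_def s_even)
  from periodic_attains_inf[of radius pi, OF smooth_continuous_on[OF smooth_radius] this]
  obtain x0 where "\<forall>x. radius x0 \<le> radius x" by auto
  then show ?thesis using radius_pos by blast
qed

text \<open>
  As \<open>\<phi>\<close> varies, \<open>contact \<phi> \<bullet> dir \<theta>\<close> has the derivative \<open>radius \<phi> * sin (\<theta> - \<phi>)\<close>.  Comparing it with the
  same expression for a circle of radius \<open>m\<close> shows that the difference increases on the half turn before
  \<open>\<phi> = \<theta>\<close> and decreases on the half turn after it.  The quantitative form yields the support inequality (\<open>m = 0\<close>), injectivity of the Gauss map
  and continuity of its inverse.
\<close>

lemma contact_inner_le:
  assumes m: "\<And>\<theta>. m \<le> radius \<theta>"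
  shows "contact \<phi> \<bullet> dir \<theta> \<le> s \<theta> - m * (1 - cos (\<theta> - \<phi>))"
proof -
  define J where "J = (\<lambda>\<psi>. contact \<psi> \<bullet> dir \<theta> - m * cos (\<theta> - \<psi>))"
  have DJ: "(J has_real_derivative (radius \<psi> - m) * sin (\<theta> - \<psi>)) (at \<psi>)" for \<psi>
    unfolding J_def by (auto intro!: derivative_eq_intros DERIV_contact_inner simp: algebra_simps)
  obtain n where n: "\<phi> + of_int n * (2 * pi) \<in> {\<theta> - pi..\<theta> - pi + 2 * pi}"
    using periodic_reduce[of "2 * pi" _ "\<theta> - pi"] pi_gt_zero by (meson mult_pos_pos zero_less_numeral)
  define \<psi> where "\<psi> = \<phi> + of_int n * (2 * pi)"
  have per: "J (x + 2 * pi) = J x" for x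
    using cos_periodic[of "\<theta> - x - 2 * pi"]
    by (simp add: J_def contact_periodic diff_diff_eq2 flip: diff_diff_eq)
  have "J \<psi> = J \<phi>" unfolding \<psi>_def using periodic_int_shift[of J "2*pi"] per by blast
  moreover have "J \<psi> \<le> J \<theta>"
  proof (cases "\<psi> \<le> \<theta>")
    case True
    show ?thesis
    proof (rule DERIV_nonneg_imp_nondecreasing[OF True])
      fix x assume "\<psi> \<le> x" "x \<le> \<theta>"
      then have "0 \<le> sin (\<theta> - x)" using n \<psi>_def by (intro sin_ge_zero) auto
      then show "\<exists>y. (J has_real_derivative y) (at x) \<and> 0 \<le> y" using DJ m by force
    qed
  next
    case False
    show ?thesis
    proof (rule DERIV_nonpos_imp_nonincreasing[of \<theta>])
      fix x assume "\<theta> \<le> x" "x \<le> \<psi>"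
      then have "0 \<le> sin (x - \<theta>)" using n \<psi>_def by (intro sin_ge_zero) auto
      then have "sin (\<theta> - x) \<le> 0" using sin_minus[of "x - \<theta>"] by simp
      then show "\<exists>y. (J has_real_derivative y) (at x) \<and> y \<le> 0"
        using DJ m by (metis diff_ge_0_iff_ge mult_nonneg_nonpos)
    qed (use False in auto)
  qed
  ultimately show ?thesis by (simp add: J_def contact_inner_self algebra_simps)
qed

lemma contact_in_body: "contact \<phi> \<in> body"
proof -
  have "contact \<phi> \<bullet> dir \<theta> \<le> s \<theta>" for \<theta>
    using contact_inner_le[of 0 \<phi> \<theta>] radius_pos by (auto simp: less_imp_le)
  then show ?thesis by (simp add: body_def)
qed

text \<open>
  For a point \<open>y\<close> of the body that touches the supporting line with normal \<open>dir \<theta>\<close>, the function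
  \<open>s \<phi> - y \<bullet> dir \<phi>\<close> is nonnegative and vanishes at \<open>\<theta>\<close>.  Its derivative vanishes there as well, which
  determines the second coordinate of \<open>y\<close> in the frame of \<open>dir \<theta>\<close>.
\<close>

lemma eq_contact:
  assumes "y \<in> body" "y \<bullet> dir \<theta> = s \<theta>"
  shows "y = contact \<theta>"
proof -
  have D: "((\<lambda>\<phi>. s \<phi> - y \<bullet> dir \<phi>) has_real_derivative
      (deriv s \<theta> - (y $ 2 * cos \<theta> - y $ 1 * sin \<theta>))) (at \<theta>)"
    unfolding inner_dir by (auto intro!: derivative_eq_intros DERIV_s)
  have "deriv s \<theta> - (y $ 2 * cos \<theta> - y $ 1 * sin \<theta>) = 0"
    by (rule DERIV_local_min[OF D, of 1]) (use assms in \<open>auto simp: body_def\<close>)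
  then have d: "deriv s \<theta> = y $ 2 * cos \<theta> - y $ 1 * sin \<theta>" by simp
  have e: "s \<theta> = y $ 1 * cos \<theta> + y $ 2 * sin \<theta>" using assms by (simp add: inner_dir)
  note sc = sin_cos_decompose[of _ \<theta>]
  show ?thesis
    unfolding vec_eq_iff forall_2 contact_nth d e
    using sc[of "y $ 1"] sc[of "y $ 2"] by (simp add: algebra_simps)
qed

text \<open>
  By compactness of the circle the gap to the supporting lines has a positive minimum, which is the
  radius of a disc around \<open>y\<close> inside the body.
\<close>

lemma interior_bodyI:
  assumes "\<And>\<theta>. y \<bullet> dir \<theta> < s \<theta>"
  shows "y \<in> interior body"
proof -
  have "continuous_on UNIV (\<lambda>\<theta>. s \<theta> - y \<bullet> dir \<theta>)"
    unfolding inner_dir by (intro continuous_intros smooth_continuous_on smooth_s)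
  then obtain x0 where x0: "\<forall>x. s x0 - y \<bullet> dir x0 \<le> s x - y \<bullet> dir x"
    using periodic_attains_inf[of "\<lambda>\<theta>. s \<theta> - y \<bullet> dir \<theta>" "2 * pi"]
    by (auto simp: s_periodic inner_dir)
  define d where "d = s x0 - y \<bullet> dir x0"
  have "d > 0" using assms[of x0] by (simp add: d_def)
  have "ball y d \<subseteq> body"
  proof
    fix z assume "z \<in> ball y d"
    then have "norm (z - y) < d" by (simp add: dist_norm norm_minus_commute)
    moreover have "(z - y) \<bullet> dir \<theta> \<le> norm (z - y)" for \<theta>
      using norm_cauchy_schwarz[of "z - y" "dir \<theta>"] by (simp add: norm_dir)
    ultimately have "z \<bullet> dir \<theta> \<le> s \<theta>" for \<theta>
      using spec[OF x0, of \<theta>] by (smt (verit) d_def inner_diff_left)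
    then show "z \<in> body" by (simp add: body_def)
  qed
  then show ?thesis using \<open>d > 0\<close> by (meson centre_in_ball interior_maximal open_ball subsetD)
qed

lemma closed_body: "closed body"
proof -
  have "body = (\<Inter>\<theta>. {y. dir \<theta> \<bullet> y \<le> s \<theta>})" by (auto simp: body_def inner_commute)
  then show ?thesis by (auto intro: closed_halfspace_le)
qed

lemma convex_body: "convex body"
proof -
  have "body = (\<Inter>\<theta>. {y. dir \<theta> \<bullet> y \<le> s \<theta>})" by (auto simp: body_def inner_commute)
  then show ?thesis by (auto intro: convex_INT convex_halfspace_le)
qed

lemma uminus_body: "uminus ` body = body"
proof -
  have d: "dir (\<theta> + pi) = - dir \<theta>" for \<theta> by (simp add: dir_def vec_eq_iff forall_2)
  have "- y \<in> body" if "y \<in> body" for y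
  proof -
    have "- y \<bullet> dir \<theta> \<le> s \<theta>" for \<theta>
      using that[unfolded body_def, simplified, rule_format, of "\<theta> + pi"] by (simp add: d s_even)
    then show ?thesis by (simp add: body_def)
  qed
  then show ?thesis by (metis (no_types, lifting) add.inverse_inverse image_iff subsetI subset_antisym image_subsetI)
qed

lemma bounded_body: "bounded body"
proof -
  obtain B where B: "\<forall>x. \<bar>s x\<bar> \<le> B"
    using periodic_bounded[of s pi] smooth_continuous_on[OF smooth_s] s_even by auto
  have "norm y \<le> B + B" if "y \<in> body" for y
  proof -
    have le: "y \<bullet> dir \<theta> \<le> B" for \<theta>
      using that spec[OF B, of \<theta>] by (simp add: body_def) (meson abs_le_D1 order_trans)
    have "- y \<in> body" using that uminus_body by blast
    then have "- (y \<bullet> dir \<theta>) \<le> s \<theta>" for \<theta> by (auto simp: body_def)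
    then have le': "- (y \<bullet> dir \<theta>) \<le> B" for \<theta>
      using spec[OF B, of \<theta>] by (meson abs_le_D1 order_trans)
    have "\<bar>y $ 1\<bar> \<le> B" "\<bar>y $ 2\<bar> \<le> B"
      using le[of 0] le'[of 0] le[of "pi/2"] le'[of "pi/2"] by (auto simp: inner_dir)
    then show ?thesis using norm_le_l1_cart[of y] by (simp add: sum_2)
  qed
  then show ?thesis using boundedI by blast
qed

lemma frontier_body: "frontier body = range contact"
proof
  show "frontier body \<subseteq> range contact"
  proof
    fix y assume "y \<in> frontier body"
    then have y: "y \<in> body" "y \<notin> interior body" by (auto simp: frontier_def closed_body)
    then obtain \<theta> where "y \<bullet> dir \<theta> = s \<theta>"
      using interior_bodyI[of y] by (metis (mono_tags, lifting) body_def mem_Collect_eq order_less_le)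
    then show "y \<in> range contact" using eq_contact y by blast
  qed
  show "range contact \<subseteq> frontier body"
  proof (clarify)
    fix \<theta>
    have "contact \<theta> \<notin> interior body"
    proof
      assume "contact \<theta> \<in> interior body"
      then obtain e where e: "e > 0" "cball (contact \<theta>) e \<subseteq> body" using mem_interior_cball by blast
      have "contact \<theta> + e *\<^sub>R dir \<theta> \<in> cball (contact \<theta>) e"
        using e by (simp add: dist_norm norm_dir)
      then have "(contact \<theta> + e *\<^sub>R dir \<theta>) \<bullet> dir \<theta> \<le> s \<theta>"
        using e(2) by (auto simp: body_def)
      then show False using e(1) norm_dir[of \<theta>]
        by (simp add: inner_add_left contact_inner_self norm_eq_1)
    qed
    then show "contact \<theta> \<in> frontier body"
      using contact_in_body by (simp add: frontier_def closed_body)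
  qed
qed

lemma strictly_convex_body: "strictly_convex body"
  unfolding strictly_convex_def
proof (intro ballI impI subsetI)
  fix x y z assume xy: "x \<in> body" "y \<in> body" "x \<noteq> y" and "z \<in> open_segment x y"
  then obtain u where u: "0 < u" "u < 1" "z = (1 - u) *\<^sub>R x + u *\<^sub>R y"
    by (auto simp: in_segment)
  show "z \<in> interior body"
  proof (rule interior_bodyI)
    fix \<theta>
    have le: "x \<bullet> dir \<theta> \<le> s \<theta>" "y \<bullet> dir \<theta> \<le> s \<theta>" using xy by (auto simp: body_def)
    have "x \<bullet> dir \<theta> < s \<theta> \<or> y \<bullet> dir \<theta> < s \<theta>"
      using le eq_contact xy by (metis order_less_le)
    then have "(1 - u) * (x \<bullet> dir \<theta>) + u * (y \<bullet> dir \<theta>) < (1 - u) * s \<theta> + u * s \<theta>"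
    proof
      assume "x \<bullet> dir \<theta> < s \<theta>"
      then show ?thesis using u le by (intro add_less_le_mono mult_strict_left_mono mult_left_mono) auto
    next
      assume "y \<bullet> dir \<theta> < s \<theta>"
      then show ?thesis using u le by (intro add_le_less_mono mult_strict_left_mono mult_left_mono) auto
    qed
    then show "z \<bullet> dir \<theta> < s \<theta>" by (simp add: u inner_add_left algebra_simps)
  qed
qed

lemma support_fn_body: "support_fn body = s"
proof
  fix \<theta>
  have "(SUP y\<in>body. y \<bullet> dir \<theta>) = s \<theta>"
  proof (rule cSup_eq_maximum)
    show "s \<theta> \<in> (\<lambda>y. y \<bullet> dir \<theta>) ` body"
      using contact_in_body contact_inner_self by (metis image_eqI)
  qed (auto simp: body_def)
  then show "support_fn body \<theta> = s \<theta>" by (simp add: support_fn_def)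
qed

lemma contact_eqD:
  assumes "contact \<phi> \<bullet> dir \<theta> = s \<theta>"
  shows "cos (\<theta> - \<phi>) = 1"
proof -
  obtain m where m: "m > 0" "\<And>\<theta>. m \<le> radius \<theta>" using radius_lower_bound by blast
  have "m * (1 - cos (\<theta> - \<phi>)) \<le> 0" using contact_inner_le[OF m(2), of \<phi> \<theta>] assms by simp
  then have "1 - cos (\<theta> - \<phi>) \<le> 0" using m(1) by (simp add: mult_le_0_iff)
  then show ?thesis using cos_le_one[of "\<theta> - \<phi>"] by linarith
qed

lemma boundary_param_contact: "boundary_param body contact"
  unfolding boundary_param_def
proof (intro conjI allI)
  fix i :: 2
  consider "i = 1" | "i = 2" using exhaust_2 by blast
  then show "smooth (\<lambda>t. contact t $ i)"
    by cases (auto simp: contact_nth intro!: smooth_intros smooth_s)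
next
  fix t
  have "deriv (\<lambda>t. contact t $ 1) t = - radius t * sin t"
    "deriv (\<lambda>t. contact t $ 2) t = radius t * cos t"
    using DERIV_contact DERIV_imp_deriv by blast+
  moreover have "sin t \<noteq> 0 \<or> cos t \<noteq> 0" using sin_zero_norm_cos_one by force
  ultimately show "\<exists>i. deriv (\<lambda>t. contact t $ i) t \<noteq> 0"
    using radius_pos[of t] by (metis mult_eq_0_iff neg_equal_0_iff_equal order_less_irrefl)
next
  show "inj_on contact {0..<2 * pi}"
  proof (rule inj_onI)
    fix a b assume ab: "a \<in> {0..<2 * pi}" "b \<in> {0..<2 * pi}" "contact a = contact b"
    then have "cos (b - a) = 1" using contact_eqD contact_inner_self by metis
    then obtain n :: int where "b - a = of_int n * 2 * pi" using cos_one_2pi_int by blast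
    moreover have "-(2*pi) < b - a" "b - a < 2 * pi" using ab by auto
    ultimately have "(- 1) * (2 * pi) < real_of_int n * (2 * pi)"
      "real_of_int n * (2 * pi) < 1 * (2 * pi)"
      by auto
    then have "- 1 < real_of_int n" "real_of_int n < 1"
      using mult_less_cancel_right_pos[of "2 * pi"] pi_gt_zero by (metis mult_pos_pos zero_less_numeral)+
    then have "n = 0" by linarith
    then show "a = b" using \<open>b - a = _\<close> by simp
  qed
qed (simp_all add: contact_periodic frontier_body)

text \<open>
  Near the point of contact every boundary point lies both on \<open>\<gamma>\<close> and on \<open>contact\<close>.  In the coordinates
  \<open>X\<close> along the tangent and \<open>Y\<close> along the normal, the quotient \<open>(Y - s \<theta>) / X\<^sup>2\<close> therefore has the same
  limit along both curves.  For \<open>contact\<close> it is \<open>- 1 / (2 radius \<theta>)\<close>; for \<open>\<gamma>\<close> it is half of the second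
  derivative of \<open>Y\<close> over the squared first derivative of \<open>X\<close>, that is, half of the curvature up to sign.
\<close>

lemma curve_curvature_at_contact:
  assumes \<gamma>: "boundary_param body \<gamma>" and touch: "\<gamma> t \<bullet> dir \<theta> = s \<theta>"
  shows "curve_curvature \<gamma> t = 1 / radius \<theta>"
proof -
  have fr: "range \<gamma> = range contact" using \<gamma> frontier_body by (simp add: boundary_param_def)
  have in_body: "\<gamma> \<tau> \<in> body" for \<tau> using fr contact_in_body by (metis rangeI imageE)
  have p: "\<gamma> t = contact \<theta>" using eq_contact in_body touch by blast
  define x where "x = (\<lambda>\<tau>. \<gamma> \<tau> $ 1)"
  define y where "y = (\<lambda>\<tau>. \<gamma> \<tau> $ 2)"
  have sm: "smooth x" "smooth y" using \<gamma> by (auto simp: boundary_param_def x_def y_def)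
  note D = smooth_DERIV[OF sm(1)] smooth_DERIV[OF sm(2)]
    smooth_DERIV[OF smooth_deriv[OF sm(1)]] smooth_DERIV[OF smooth_deriv[OF sm(2)]]
  obtain i :: 2 where "deriv (\<lambda>\<tau>. \<gamma> \<tau> $ i) t \<noteq> 0"
    using \<gamma> unfolding boundary_param_def by blast
  then have reg: "deriv x t \<noteq> 0 \<or> deriv y t \<noteq> 0"
    using exhaust_2[of i] by (auto simp: x_def y_def)
  \<comment> \<open>Coordinates along the tangent and along the normal at the common point.\<close>
  define T where "T = (\<lambda>v :: real ^ 2. - (v $ 1 - contact \<theta> $ 1) * sin \<theta> + (v $ 2 - contact \<theta> $ 2) * cos \<theta>)"
  define X where "X = (\<lambda>\<tau>. T (\<gamma> \<tau>))"
  define Y where "Y = (\<lambda>\<tau>. \<gamma> \<tau> \<bullet> dir \<theta>)"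
  define X' where "X' = - deriv x t * sin \<theta> + deriv y t * cos \<theta>"
  define Y' where "Y' = (\<lambda>\<tau>. deriv x \<tau> * cos \<theta> + deriv y \<tau> * sin \<theta>)"
  define Y'' where "Y'' = deriv (deriv x) t * cos \<theta> + deriv (deriv y) t * sin \<theta>"
  have X_eq: "X = (\<lambda>\<tau>. - (x \<tau> - contact \<theta> $ 1) * sin \<theta> + (y \<tau> - contact \<theta> $ 2) * cos \<theta>)"
    by (simp add: X_def T_def x_def y_def)
  have Y_eq: "Y = (\<lambda>\<tau>. x \<tau> * cos \<theta> + y \<tau> * sin \<theta>)"
    by (simp add: Y_def inner_dir x_def y_def)
  have DX: "(X has_real_derivative X') (at t)"
    unfolding X_eq X'_def
    by (auto intro!: derivative_eq_intros D)
  have DY: "(Y has_real_derivative Y' \<tau>) (at \<tau>)" for \<tau>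
    unfolding Y_eq Y'_def
    by (auto intro!: derivative_eq_intros D)
  have DY': "(Y' has_real_derivative Y'') (at t)"
    unfolding Y'_def Y''_def by (auto intro!: derivative_eq_intros D)
  have "Y' t = 0"
    by (rule DERIV_local_max[OF DY, of 1]) (use in_body touch in \<open>auto simp: body_def Y_def\<close>)
  note sc = sin_cos_decompose[of _ \<theta>]
  have xt: "deriv x t = - X' * sin \<theta>"
  proof -
    have "deriv x t = Y' t * cos \<theta> - X' * sin \<theta>"
      using sc[of "deriv x t"] by (simp add: Y'_def X'_def algebra_simps)
    then show ?thesis using \<open>Y' t = 0\<close> by simp
  qed
  have yt: "deriv y t = X' * cos \<theta>"
  proof -
    have "deriv y t = Y' t * sin \<theta> + X' * cos \<theta>"
      using sc[of "deriv y t"] by (simp add: Y'_def X'_def algebra_simps)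
    then show ?thesis using \<open>Y' t = 0\<close> by simp
  qed
  have "X' \<noteq> 0" using reg xt yt by auto
  have Xt: "X t = 0" by (simp add: X_def T_def p)
  have X_lim: "((\<lambda>\<tau>. X \<tau> / (\<tau> - t)) \<longlongrightarrow> X') (at t)"
    using DX by (simp add: has_field_derivative_iff Xt)
  have "((\<lambda>\<tau>. ((Y \<tau> - Y t) / (\<tau> - t)\<^sup>2) / (X \<tau> / (\<tau> - t))\<^sup>2) \<longlongrightarrow> (Y'' / 2) / X'\<^sup>2) (at t)"
    by (intro tendsto_intros X_lim second_difference_quotient[OF DY DY' \<open>Y' t = 0\<close>])
      (use \<open>X' \<noteq> 0\<close> in auto)
  moreover have "\<forall>\<^sub>F \<tau> in at t. ((Y \<tau> - Y t) / (\<tau> - t)\<^sup>2) / (X \<tau> / (\<tau> - t))\<^sup>2 = (Y \<tau> - s \<theta>) / (X \<tau>)\<^sup>2"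
    using touch by (auto simp: eventually_at_filter Y_def power_divide)
  ultimately have lim1: "((\<lambda>\<tau>. (Y \<tau> - s \<theta>) / (X \<tau>)\<^sup>2) \<longlongrightarrow> (Y'' / 2) / X'\<^sup>2) (at t)"
    by (rule Lim_transform_eventually)
  define A where "A = (\<lambda>\<phi>. contact \<phi> \<bullet> dir \<theta>)"
  define B where "B = (\<lambda>\<phi>. T (contact \<phi>))"
  have "(B has_real_derivative radius \<theta> * (cos \<theta> * cos \<theta>) + radius \<theta> * (sin \<theta> * sin \<theta>)) (at \<theta>)"
    unfolding B_def T_def by (auto intro!: derivative_eq_intros DERIV_contact)
  then have DB: "(B has_real_derivative radius \<theta>) (at \<theta>)"
    using sc[of "radius \<theta>"] by (simp add: mult.assoc)
  have B_lim: "((\<lambda>\<phi>. B \<phi> / (\<phi> - \<theta>)) \<longlongrightarrow> radius \<theta>) (at \<theta>)"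
    using DB by (simp add: has_field_derivative_iff) (simp add: B_def T_def)
  have DA: "(A has_real_derivative radius \<phi> * sin (\<theta> - \<phi>)) (at \<phi>)" for \<phi>
    unfolding A_def by (rule DERIV_contact_inner)
  have DA': "((\<lambda>\<phi>. radius \<phi> * sin (\<theta> - \<phi>)) has_real_derivative - radius \<theta>) (at \<theta>)"
    by (auto intro!: derivative_eq_intros smooth_DERIV smooth_radius)
  have "((\<lambda>\<phi>. ((A \<phi> - A \<theta>) / (\<phi> - \<theta>)\<^sup>2) / (B \<phi> / (\<phi> - \<theta>))\<^sup>2) \<longlongrightarrow> (- radius \<theta> / 2) / (radius \<theta>)\<^sup>2) (at \<theta>)"
    by (intro tendsto_intros B_lim second_difference_quotient[OF DA DA'])
      (use radius_pos[of \<theta>] in auto)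
  moreover have "\<forall>\<^sub>F \<phi> in at \<theta>. ((A \<phi> - A \<theta>) / (\<phi> - \<theta>)\<^sup>2) / (B \<phi> / (\<phi> - \<theta>))\<^sup>2 = (A \<phi> - s \<theta>) / (B \<phi>)\<^sup>2"
    by (auto simp: eventually_at_filter A_def contact_inner_self power_divide)
  ultimately have lim2: "((\<lambda>\<phi>. (A \<phi> - s \<theta>) / (B \<phi>)\<^sup>2) \<longlongrightarrow> (- radius \<theta> / 2) / (radius \<theta>)\<^sup>2) (at \<theta>)"
    by (rule Lim_transform_eventually)
  \<comment> \<open>The angle of the normal along \<open>\<gamma>\<close>, chosen in the window around \<open>\<theta>\<close> on which it is continuous at \<open>t\<close>.\<close>
  have "\<exists>\<phi>. \<gamma> \<tau> = contact \<phi> \<and> \<bar>\<theta> - \<phi>\<bar> \<le> pi" for \<tau>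
  proof -
    obtain \<phi> where "\<gamma> \<tau> = contact \<phi>" using fr by blast
    moreover obtain n where "\<phi> + of_int n * (2 * pi) \<in> {\<theta> - pi..\<theta> - pi + 2 * pi}"
      using periodic_reduce[of "2 * pi" _ "\<theta> - pi"] pi_gt_zero by (meson mult_pos_pos zero_less_numeral)
    moreover have "contact (\<phi> + of_int n * (2 * pi)) = contact \<phi>"
      by (rule periodic_int_shift) (rule contact_periodic)
    ultimately show ?thesis by (intro exI[of _ "\<phi> + of_int n * (2 * pi)"]) (auto simp: abs_le_iff)
  qed
  then obtain \<Theta> where \<Theta>: "\<And>\<tau>. \<gamma> \<tau> = contact (\<Theta> \<tau>)" "\<And>\<tau>. \<bar>\<theta> - \<Theta> \<tau>\<bar> \<le> pi" by metis
  have "\<forall>\<^sub>F \<tau> in at t. X \<tau> / (\<tau> - t) \<noteq> 0"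
    using X_lim \<open>X' \<noteq> 0\<close> tendsto_imp_eventually_ne by blast
  then have ne: "\<forall>\<^sub>F \<tau> in at t. \<Theta> \<tau> \<noteq> \<theta>"
    by eventually_elim (auto simp: X_def T_def \<Theta>)
  have \<Theta>_lim: "(\<Theta> \<longlongrightarrow> \<theta>) (at t)"
  proof -
    obtain m where m: "m > 0" "\<And>\<theta>. m \<le> radius \<theta>" using radius_lower_bound by blast
    have "(Y \<longlongrightarrow> s \<theta>) (at t)"
      using DERIV_isCont[OF DY[of t]] touch by (simp add: isCont_def Y_def)
    then have lo: "((\<lambda>\<tau>. 1 - (s \<theta> - Y \<tau>) / m) \<longlongrightarrow> 1 - (s \<theta> - s \<theta>) / m) (at t)"
      by (intro tendsto_intros) (use m in auto)
    have bnd: "1 - (s \<theta> - Y \<tau>) / m \<le> cos (\<theta> - \<Theta> \<tau>)" for \<tau>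
    proof -
      have "m * (1 - cos (\<theta> - \<Theta> \<tau>)) \<le> s \<theta> - Y \<tau>"
        using contact_inner_le[OF m(2), of "\<Theta> \<tau>" \<theta>] by (simp add: Y_def \<Theta>(1))
      then show ?thesis using m(1) by (simp add: field_simps)
    qed
    have "((\<lambda>\<tau>. cos (\<theta> - \<Theta> \<tau>)) \<longlongrightarrow> 1) (at t)"
      by (rule tendsto_sandwich[OF _ _ _ tendsto_const]) (use lo bnd in auto)
    then have "((\<lambda>\<tau>. arccos (cos (\<theta> - \<Theta> \<tau>))) \<longlongrightarrow> arccos 1) (at t)"
      by (intro continuous_on_tendsto_compose[OF continuous_on_arccos']) auto
    moreover have "arccos (cos (\<theta> - \<Theta> \<tau>)) = \<bar>\<theta> - \<Theta> \<tau>\<bar>" for \<tau>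
      using arccos_cos[of "\<bar>\<theta> - \<Theta> \<tau>\<bar>"] \<Theta>(2)[of \<tau>] by (simp add: cos_abs_real)
    ultimately have "((\<lambda>\<tau>. \<bar>\<theta> - \<Theta> \<tau>\<bar>) \<longlongrightarrow> 0) (at t)" by simp
    then have "((\<lambda>\<tau>. \<theta> - (\<theta> - \<Theta> \<tau>)) \<longlongrightarrow> \<theta> - 0) (at t)"
      by (intro tendsto_diff tendsto_const) (simp add: tendsto_rabs_zero_iff)
    then show ?thesis by simp
  qed
  have "filterlim \<Theta> (at \<theta>) (at t)" using \<Theta>_lim ne by (simp add: filterlim_at)
  from filterlim_compose[OF lim2 this]
  have "((\<lambda>\<tau>. (Y \<tau> - s \<theta>) / (X \<tau>)\<^sup>2) \<longlongrightarrow> (- radius \<theta> / 2) / (radius \<theta>)\<^sup>2) (at t)"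
    by (simp add: A_def B_def X_def Y_def \<Theta>(1))
  from tendsto_unique[OF _ lim1 this] have "Y'' / 2 / X'\<^sup>2 = - radius \<theta> / 2 / (radius \<theta>)\<^sup>2" by simp
  then have Y'': "Y'' = - X'\<^sup>2 / radius \<theta>"
    using \<open>X' \<noteq> 0\<close> radius_pos[of \<theta>] by (simp add: field_simps power2_eq_square)
  have num: "deriv x t * deriv (deriv y) t - deriv y t * deriv (deriv x) t = - X' * Y''"
    by (simp add: xt yt Y''_def algebra_simps)
  have den: "(deriv x t)\<^sup>2 + (deriv y t)\<^sup>2 = X'\<^sup>2"
    by (simp add: xt yt power_mult_distrib flip: distrib_left)
  have "curve_curvature \<gamma> t = \<bar>X' * Y''\<bar> / \<bar>X'\<bar> ^ 3"
    unfolding curve_curvature_def Let_def funpow_2_deriv x_def[symmetric] y_def[symmetric]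
    by (simp add: num den)
  also have "\<dots> = 1 / radius \<theta>"
    using \<open>X' \<noteq> 0\<close> radius_pos[of \<theta>] by (simp add: Y'' abs_mult field_simps power2_eq_square power3_eq_cube)
  finally show ?thesis .
qed

lemma boundary_curvature_body: "boundary_curvature body \<theta> = 1 / radius \<theta>"
  unfolding boundary_curvature_def support_fn_body
  by (rule the_equality)
    (use boundary_param_contact contact_inner_self curve_curvature_at_contact in metis)+

lemma body_in_K_sym: "body \<in> K_sym"
proof -
  have "curve_curvature contact t > 0" for t
    using curve_curvature_at_contact[OF boundary_param_contact contact_inner_self] radius_pos by simp
  moreover have "0 \<in> interior body" by (rule interior_bodyI) (simp add: s_pos)
  moreover have "compact body" using closed_body bounded_body compact_eq_bounded_closed by blast
  ultimately show ?thesis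
    using convex_body strictly_convex_body uminus_body boundary_param_contact
    by (auto simp: K_sym_def)
qed

end

lemma exists_body_with_support:
  assumes "even_support s"
  obtains K where "K \<in> K_sym" "support_fn K = s"
    "\<And>\<theta>. boundary_curvature K \<theta> = 1 / ((deriv ^^ 2) s \<theta> + s \<theta>)"
proof -
  interpret even_support s by fact
  show ?thesis
    using that[OF body_in_K_sym support_fn_body] boundary_curvature_body
    by (simp add: radius_def funpow_2_deriv)
qed

section \<open>The periodic Green's function of the operator \<open>s'' + s\<close>\<close>

lemma antiderivative_exists:
  fixes g :: "real \<Rightarrow> real"
  assumes "continuous_on UNIV g"
  shows "\<exists>A. \<forall>x. (A has_real_derivative g x) (at x)"
  using einterval_antiderivative[of "-\<infinity>" "\<infinity>" g] assms
  by (auto simp: continuous_on_eq_continuous_at has_real_derivative_iff_has_vector_derivative)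

lemma integral_periodic_window:
  fixes g :: "real \<Rightarrow> real"
  assumes cont: "continuous_on UNIV g" and per: "\<And>x. g (x + T) = g x" and "T \<ge> 0"
  shows "integral {x..x+T} g = integral {y..y+T} g"
proof -
  obtain A where A: "\<And>x. (A has_real_derivative g x) (at x)"
    using antiderivative_exists[OF cont] by blast
  have I: "integral {x..x+T} g = A (x + T) - A x" for x
    by (rule integral_unique, rule fundamental_theorem_of_calculus)
      (use A \<open>T \<ge> 0\<close> in \<open>auto simp: has_real_derivative_iff_has_vector_derivative[symmetric]
        intro: has_field_derivative_at_within\<close>)
  have "((\<lambda>x. A (x + T) - A x) has_real_derivative 0) (at z)" for z
    using DERIV_diff[OF DERIV_shift[THEN iffD1, OF A[of "z + T"]] A[of z]] by (simp add: per)
  then have "A (x + T) - A x = A (y + T) - A y"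
    using DERIV_isconst_all[of "\<lambda>x. A (x + T) - A x"] by blast
  then show ?thesis by (simp add: I)
qed

text \<open>
  The kernel \<open>cos (t - T / 2) / (2 sin (T / 2))\<close> for \<open>0 \<le> t \<le> T\<close>, extended with period \<open>T\<close>, is the Green's
  function of \<open>s'' + s\<close> on a circle of length \<open>T\<close>.  The moving window \<open>{x..x + T}\<close> keeps its corner at
  the end points.
\<close>

definition green :: "real \<Rightarrow> (real \<Rightarrow> real) \<Rightarrow> real \<Rightarrow> real" where
  "green T g x = integral {x..x+T} (\<lambda>y. cos (y - x - T / 2) * g y) / (2 * sin (T / 2))"

text \<open>
  The addition theorem for \<open>cos (y - x - T / 2)\<close> takes \<open>x\<close> out of the integrands, and what remains are
  differences of antiderivatives at the ends of the window.
\<close>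

lemma green_DERIV:
  fixes g :: "real \<Rightarrow> real"
  assumes cont: "continuous_on UNIV g" and per: "\<And>x. g (x + T) = g x" and T: "0 < T" "T \<le> pi"
  shows "\<exists>D. \<forall>x. (green T g has_real_derivative D x) (at x) \<and>
               (D has_real_derivative (g x - green T g x)) (at x)"
proof -
  define h where "h = T / 2"
  have sin_h: "sin h > 0" using T unfolding h_def by (intro sin_gt_zero) auto
  have cs: "continuous_on UNIV (\<lambda>y. cos y * g y)" "continuous_on UNIV (\<lambda>y. sin y * g y)"
    by (intro continuous_intros cont)+
  obtain C where C: "\<And>x. (C has_real_derivative cos x * g x) (at x)"
    using antiderivative_exists[OF cs(1)] by blast
  obtain S where S: "\<And>x. (S has_real_derivative sin x * g x) (at x)"
    using antiderivative_exists[OF cs(2)] by blast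
  have C': "((\<lambda>x. C (x + T)) has_real_derivative cos (x + T) * g x) (at x)" for x
    using DERIV_shift[THEN iffD1, OF C[of "x + T"]] by (simp add: per)
  have S': "((\<lambda>x. S (x + T)) has_real_derivative sin (x + T) * g x) (at x)" for x
    using DERIV_shift[THEN iffD1, OF S[of "x + T"]] by (simp add: per)
  have G: "green T g x =
      (cos (x + h) * (C (x + T) - C x) + sin (x + h) * (S (x + T) - S x)) / (2 * sin h)" for x
  proof -
    let ?F = "\<lambda>y. cos (x + h) * C y + sin (x + h) * S y"
    have "(?F has_real_derivative cos (y - x - h) * g y) (at y)" for y
    proof -
      have "cos (y - x - h) = cos (y - (x + h))" by (simp add: algebra_simps)
      also have "\<dots> = cos (x + h) * cos y + sin (x + h) * sin y" by (simp add: cos_diff)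
      finally show ?thesis
        by (auto intro!: derivative_eq_intros C S simp: algebra_simps)
    qed
    then have "((\<lambda>y. cos (y - x - h) * g y) has_integral ?F (x + T) - ?F x) {x..x+T}"
      using T by (intro fundamental_theorem_of_calculus)
        (auto simp: has_real_derivative_iff_has_vector_derivative[symmetric]
          intro: has_field_derivative_at_within)
    then show ?thesis
      by (simp add: green_def h_def integral_unique algebra_simps)
  qed
  have up: "cos (x + T) = cos (x + h) * cos h - sin (x + h) * sin h"
    "sin (x + T) = sin (x + h) * cos h + cos (x + h) * sin h" for x
  proof -
    have "x + T = (x + h) + h" by (simp add: h_def)
    then show "cos (x + T) = cos (x + h) * cos h - sin (x + h) * sin h"
      "sin (x + T) = sin (x + h) * cos h + cos (x + h) * sin h"
      by (simp_all only: cos_add[of "x + h" h] sin_add[of "x + h" h])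
  qed
  have down: "cos x = cos (x + h) * cos h + sin (x + h) * sin h"
    "sin x = sin (x + h) * cos h - cos (x + h) * sin h" for x
    by (rule cos_diff[of "x + h" h, simplified add_diff_cancel_right']
        sin_diff[of "x + h" h, simplified add_diff_cancel_right'])+
  define P where "P = (\<lambda>x. C (x + T) - C x)"
  define Q where "Q = (\<lambda>x. S (x + T) - S x)"
  have DP: "(P has_real_derivative (cos (x + T) - cos x) * g x) (at x)" for x
    unfolding P_def using DERIV_diff[OF C' C] by (simp add: left_diff_distrib)
  have DQ: "(Q has_real_derivative (sin (x + T) - sin x) * g x) (at x)" for x
    unfolding Q_def using DERIV_diff[OF S' S] by (simp add: left_diff_distrib)
  have Dcs: "((\<lambda>x. cos (x + h)) has_real_derivative - sin (x + h)) (at x)"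
    "((\<lambda>x. sin (x + h)) has_real_derivative cos (x + h)) (at x)" for x
    by (auto intro!: derivative_eq_intros)
  have G': "green T g = (\<lambda>x. (cos (x + h) * P x + sin (x + h) * Q x) / (2 * sin h))"
    by (simp add: fun_eq_iff G P_def Q_def)
  define D where "D = (\<lambda>x. (- sin (x + h) * P x + cos (x + h) * Q x) / (2 * sin h))"
  \<comment> \<open>The contributions of the two ends cancel in the first derivative and add up to \<open>g\<close> in the second.\<close>
  have jump: "cos (x + h) * (cos (x + T) - cos x) + sin (x + h) * (sin (x + T) - sin x) = 0"
    "- sin (x + h) * (cos (x + T) - cos x) + cos (x + h) * (sin (x + T) - sin x) = 2 * sin h" for x
    using sin_cos_decompose[of "sin h" "x + h"] unfolding up down[of x] by (simp_all add: algebra_simps)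
  have "(green T g has_real_derivative D x) (at x)" for x
  proof -
    have "((\<lambda>x. (cos (x + h) * P x + sin (x + h) * Q x) / (2 * sin h)) has_real_derivative
        ((- sin (x + h)) * P x + (cos (x + T) - cos x) * g x * cos (x + h) +
         (cos (x + h) * Q x + (sin (x + T) - sin x) * g x * sin (x + h))) / (2 * sin h)) (at x)"
      by (intro DERIV_cdivide DERIV_add DERIV_mult Dcs DP DQ)
    moreover have "(- sin (x + h)) * P x + (cos (x + T) - cos x) * g x * cos (x + h) +
         (cos (x + h) * Q x + (sin (x + T) - sin x) * g x * sin (x + h)) =
       - sin (x + h) * P x + cos (x + h) * Q x +
         (cos (x + h) * (cos (x + T) - cos x) + sin (x + h) * (sin (x + T) - sin x)) * g x"
      by (simp add: algebra_simps)
    ultimately show ?thesis unfolding jump(1) G' D_def by (simp only: mult_zero_left add_0_right)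
  qed
  moreover have "(D has_real_derivative (g x - green T g x)) (at x)" for x
  proof -
    have "(D has_real_derivative
        (- cos (x + h) * P x + (cos (x + T) - cos x) * g x * (- sin (x + h)) +
         ((- sin (x + h)) * Q x + (sin (x + T) - sin x) * g x * cos (x + h))) / (2 * sin h)) (at x)"
      unfolding D_def
      by (intro DERIV_cdivide DERIV_add DERIV_mult DERIV_minus Dcs DP DQ)
    moreover have "- cos (x + h) * P x + (cos (x + T) - cos x) * g x * (- sin (x + h)) +
         ((- sin (x + h)) * Q x + (sin (x + T) - sin x) * g x * cos (x + h)) =
       - (cos (x + h) * P x + sin (x + h) * Q x) +
         (- sin (x + h) * (cos (x + T) - cos x) + cos (x + h) * (sin (x + T) - sin x)) * g x"
      by (simp add: algebra_simps)
    ultimately have "(D has_real_derivative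
        (- (cos (x + h) * P x + sin (x + h) * Q x) + 2 * sin h * g x) / (2 * sin h)) (at x)"
      unfolding jump(2) by (simp only:)
    moreover have "(- a + 2 * sin h * b) / (2 * sin h) = b - a / (2 * sin h)" for a b
      using sin_h by (simp add: field_simps)
    ultimately show ?thesis unfolding G' by (simp only:)
  qed
  ultimately show ?thesis by blast
qed

lemma green_periodic:
  assumes per: "\<And>x. g (x + T) = g x"
  shows "green T g (x + T) = green T g x"
proof -
  have "integral {x + T..x + T + T} (\<lambda>y. cos (y - (x + T) - T / 2) * g y) =
        integral {x..x + T} ((\<lambda>y. cos (y - (x + T) - T / 2) * g y) \<circ> (+) T)"
    by (simp only: integral_shift_Icc_real)
  also have "\<dots> = integral {x..x + T} (\<lambda>y. cos (y - x - T / 2) * g y)"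
  proof (rule integral_cong)
    fix y
    have "g (T + y) = g y" using per[of y] by (simp add: add.commute)
    moreover have "T + y - (x + T) - T / 2 = y - x - T / 2" by simp
    ultimately show "((\<lambda>y. cos (y - (x + T) - T / 2) * g y) \<circ> (+) T) y = cos (y - x - T / 2) * g y"
      by (simp only: o_def)
  qed
  finally show ?thesis by (simp add: green_def)
qed

lemma green_continuous:
  assumes "continuous_on UNIV g" "\<And>x. g (x + T) = g x" "0 < T" "T \<le> pi"
  shows "continuous_on UNIV (green T g)"
proof -
  obtain D where "\<forall>x. (green T g has_real_derivative D x) (at x)"
    using green_DERIV[of g T] assms by blast
  then show ?thesis
    by (meson DERIV_isCont continuous_at_imp_continuous_on)
qed

text \<open>
  Bootstrapping:  if the second derivative of \<open>w\<close> is as regular as \<open>w\<close>, then \<open>w\<close> is smooth.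
\<close>

lemma smooth_second_order:
  assumes w: "\<And>x. (w has_real_derivative w' x) (at x)"
    and w': "\<And>x. (w' has_real_derivative F x) (at x)"
    and F: "\<And>n. differentiable_upto n w \<Longrightarrow> differentiable_upto n F"
  shows "smooth w" "(deriv ^^ 2) w = F"
proof -
  have "differentiable_upto n w \<and> differentiable_upto n w'" for n
  proof (induction n)
    case 0
    then show ?case using w w' by (auto simp: differentiable_upto_0 real_differentiable_def)
  next
    case (Suc n)
    then show ?case using differentiable_upto_SucI[OF w] differentiable_upto_SucI[OF w'] F by blast
  qed
  then show "smooth w" by (simp add: smooth_iff_differentiable_upto)
  have "deriv w = w'" "deriv w' = F" using w w' by (auto intro: DERIV_imp_deriv)
  then show "(deriv ^^ 2) w = F" by (simp add: funpow_2_deriv)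
qed

lemma cos_window:
  assumes "0 < T" "T \<le> pi" "y \<in> {x..x+T}"
  shows "cos (T / 2) \<le> cos (y - x - T / 2)"
proof -
  have "\<bar>y - x - T / 2\<bar> \<le> T / 2" using assms unfolding abs_le_iff by (simp add: field_simps)
  then have "cos (T / 2) \<le> cos \<bar>y - x - T / 2\<bar>"
    using assms by (intro cos_monotone_0_pi_le) auto
  then show ?thesis by simp
qed

lemma green_pos:
  assumes cont: "continuous_on UNIV g" and g: "\<And>x. g x > 0" and T: "0 < T" "T < pi"
  shows "green T g x > 0"
proof -
  have c: "cos (T / 2) > 0" using T by (intro cos_gt_zero) auto
  have cg: "continuous_on {x..x+T} g" using cont continuous_on_subset by blast
  have "continuous_on {x..x+T} (\<lambda>y. cos (y - x - T / 2) * g y)"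
    by (intro continuous_intros cg)
  moreover have "0 < cos (y - x - T / 2) * g y" if "y \<in> {x..x+T}" for y
    using cos_window[OF T(1) _ that] T c g[of y] by auto
  ultimately have "0 < integral {x..x+T} (\<lambda>y. cos (y - x - T / 2) * g y)"
    using integral_less_real[of x "x+T" "\<lambda>_. 0" "\<lambda>y. cos (y - x - T / 2) * g y"] T by auto
  moreover have "sin (T / 2) > 0" using T by (intro sin_gt_zero) auto
  ultimately show ?thesis by (simp add: green_def)
qed

lemma green_scale: "green T (\<lambda>y. a * g y) x = a * green T g x"
  by (simp add: green_def mult.left_commute)

section \<open>Contraction of logarithmic oscillation\<close>

text \<open>
  The kernel \<open>k\<close> is at least \<open>c\<close>, so the weight \<open>k w\<close> dominates \<open>c w\<close>, while its total mass is at most that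
  of \<open>w\<close>.  Hence the mean of \<open>h - m \<ge> 0\<close> with the weight \<open>k w\<close> is at least \<open>c\<close> times its mean with the
  weight \<open>w\<close>.
\<close>

lemma weighted_mean_ge:
  fixes k w h :: "real \<Rightarrow> real"
  assumes ab: "a < b"
    and cont: "continuous_on {a..b} k" "continuous_on {a..b} w" "continuous_on {a..b} h"
    and k: "\<And>y. y \<in> {a..b} \<Longrightarrow> c \<le> k y" "\<And>y. y \<in> {a..b} \<Longrightarrow> k y \<le> 1" "c > 0"
    and w: "\<And>y. y \<in> {a..b} \<Longrightarrow> w y > 0"
    and h: "\<And>y. y \<in> {a..b} \<Longrightarrow> m \<le> h y"
  shows "m + c * (integral {a..b} (\<lambda>y. w y * h y) / integral {a..b} w - m)
    \<le> integral {a..b} (\<lambda>y. k y * (w y * h y)) / integral {a..b} (\<lambda>y. k y * w y)"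
proof -
  let ?A = "integral {a..b} w" and ?B = "integral {a..b} (\<lambda>y. w y * h y)"
  let ?K = "integral {a..b} (\<lambda>y. k y * w y)" and ?N = "integral {a..b} (\<lambda>y. k y * (w y * h y))"
  note int = integrable_continuous_real
  have cw: "continuous_on {a..b} (\<lambda>y. k y * w y)"
    and cwh: "continuous_on {a..b} (\<lambda>y. w y * h y)"
    and ckwh: "continuous_on {a..b} (\<lambda>y. k y * (w y * h y))"
    by (intro continuous_intros cont)+
  have kpos: "k y > 0" if "y \<in> {a..b}" for y using k(1)[OF that] k(3) by linarith
  have K: "?K > 0"
    using integral_less_real[of a b "\<lambda>_. 0" "\<lambda>y. k y * w y"] ab cw kpos w by auto
  have KA: "?K \<le> ?A"
    by (rule integral_le[OF int[OF cw] int[OF cont(2)]]) (use k(2) w in \<open>simp add: less_imp_le\<close>)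
  have wh: "0 \<le> w y * (h y - m)" if "y \<in> {a..b}" for y
    using w[OF that] h[OF that] by simp
  have B: "0 \<le> integral {a..b} (\<lambda>y. w y * (h y - m))"
    by (rule integral_nonneg) (use wh in \<open>auto intro!: int continuous_intros cont\<close>)
  have "integral {a..b} (\<lambda>y. c * (w y * (h y - m))) \<le> integral {a..b} (\<lambda>y. k y * (w y * (h y - m)))"
    by (rule integral_le)
      (use k(1) wh in \<open>auto intro!: int continuous_intros cont mult_right_mono\<close>)
  moreover have "integral {a..b} (\<lambda>y. w y * (h y - m)) = ?B - m * ?A"
    using integral_diff[OF int[OF cwh] int[OF continuous_on_mult_left[OF cont(2), of m]]]
    by (simp add: algebra_simps)
  moreover have "integral {a..b} (\<lambda>y. k y * (w y * (h y - m))) = ?N - m * ?K"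
    using integral_diff[OF int[OF ckwh] int[OF continuous_on_mult_left[OF cw, of m]]]
    by (simp add: algebra_simps)
  ultimately have N: "c * (?B - m * ?A) \<le> ?N - m * ?K" and B': "0 \<le> ?B - m * ?A"
    using B by simp_all
  have "c * (?B / ?A - m) = c * (?B - m * ?A) / ?A" using K KA by (simp add: field_simps)
  also have "\<dots> \<le> c * (?B - m * ?A) / ?K"
    using B' k(3) K KA by (intro divide_left_mono) auto
  also have "\<dots> \<le> (?N - m * ?K) / ?K" using N K by (intro divide_right_mono) auto
  also have "\<dots> = ?N / ?K - m" using K by (simp add: field_simps)
  finally show ?thesis by simp
qed

lemma weighted_mean_bounds:
  fixes k w h :: "real \<Rightarrow> real"
  assumes ab: "a < b"
    and cont: "continuous_on {a..b} k" "continuous_on {a..b} w" "continuous_on {a..b} h"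
    and k: "\<And>y. y \<in> {a..b} \<Longrightarrow> c \<le> k y" "\<And>y. y \<in> {a..b} \<Longrightarrow> k y \<le> 1" "c > 0"
    and w: "\<And>y. y \<in> {a..b} \<Longrightarrow> w y > 0"
    and h: "\<And>y. y \<in> {a..b} \<Longrightarrow> m \<le> h y" "\<And>y. y \<in> {a..b} \<Longrightarrow> h y \<le> M"
  shows "integral {a..b} (\<lambda>y. k y * (w y * h y)) / integral {a..b} (\<lambda>y. k y * w y)
    \<in> {m + c * (integral {a..b} (\<lambda>y. w y * h y) / integral {a..b} w - m) ..
       M - c * (M - integral {a..b} (\<lambda>y. w y * h y) / integral {a..b} w)}"
  using weighted_mean_ge[OF ab cont k w h(1)]
    weighted_mean_ge[OF ab cont(1,2) continuous_on_minus[OF cont(3)] k w, of "- M"] h(2)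
  by (simp add: algebra_simps)

text \<open>
  The mean of \<open>h\<close> with the weight \<open>w\<close> over a period does not depend on the window.  The means formed with
  the kernel at \<open>x\<close> and at \<open>x'\<close> are therefore confined to one common interval of the length given here.
\<close>

lemma green_mean_oscillation:
  assumes cont: "continuous_on UNIV w" "continuous_on UNIV h"
    and per: "\<And>x. w (x + T) = w x" "\<And>x. h (x + T) = h x"
    and w: "\<And>x. w x > 0" and h: "\<And>x. m \<le> h x" "\<And>x. h x \<le> M"
    and T: "0 < T" "T < pi"
  shows "\<bar>green T (\<lambda>y. w y * h y) x / green T w x - green T (\<lambda>y. w y * h y) x' / green T w x'\<bar>
    \<le> (1 - cos (T / 2)) * (M - m)"
proof -
  define H where "H = integral {0..0+T} (\<lambda>y. w y * h y) / integral {0..0+T} w"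
  have c: "cos (T / 2) > 0" using T by (intro cos_gt_zero) auto
  have s: "sin (T / 2) > 0" using T by (intro sin_gt_zero) auto
  have *: "green T (\<lambda>y. w y * h y) x / green T w x \<in> {m + cos (T / 2) * (H - m) .. M - cos (T / 2) * (M - H)}" for x
  proof -
    have sub: "continuous_on {x..x+T} w" "continuous_on {x..x+T} h"
      using cont continuous_on_subset by blast+
    have H: "integral {x..x+T} (\<lambda>y. w y * h y) / integral {x..x+T} w = H"
      unfolding H_def
      using integral_periodic_window[of w T x 0] integral_periodic_window[of "\<lambda>y. w y * h y" T x 0]
        cont per T by (simp add: continuous_on_mult)
    have "green T (\<lambda>y. w y * h y) x / green T w x =
        integral {x..x+T} (\<lambda>y. cos (y - x - T / 2) * (w y * h y)) / integral {x..x+T} (\<lambda>y. cos (y - x - T / 2) * w y)"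
      using s by (simp add: green_def)
    then show ?thesis
      using weighted_mean_bounds[of x "x+T" "\<lambda>y. cos (y - x - T / 2)" w h "cos (T / 2)" m M]
        sub T c w h cos_window[of T _ x] unfolding H by (simp add: continuous_intros)
  qed
  show ?thesis using *[of x] *[of x'] by (auto simp: abs_le_iff algebra_simps)
qed

text \<open>
  Joining the weights \<open>w\<close> and \<open>w exp h\<close> by \<open>w exp (\<tau> h)\<close>, the derivative of \<open>ln (green T (w exp (\<tau> h)) x)\<close> in
  \<open>\<tau>\<close> is a weighted mean of \<open>h\<close>.  The mean value theorem reduces the claim to the oscillation of such
  means in \<open>x\<close>.
\<close>

lemma green_ln_oscillation:
  assumes cont: "continuous_on UNIV w" "continuous_on UNIV h"
    and per: "\<And>x. w (x + T) = w x" "\<And>x. h (x + T) = h x"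
    and w: "\<And>x. w x > 0" and h: "\<And>x. m \<le> h x" "\<And>x. h x \<le> M"
    and T: "0 < T" "T < pi"
  shows "\<bar>(ln (green T (\<lambda>y. w y * exp (h y)) x) - ln (green T w x)) -
          (ln (green T (\<lambda>y. w y * exp (h y)) x') - ln (green T w x'))\<bar> \<le> (1 - cos (T / 2)) * (M - m)"
proof -
  define W where "W = (\<lambda>\<tau> y. w y * exp (\<tau> * h y))"
  have cW: "continuous_on UNIV (W \<tau>)" for \<tau>
    unfolding W_def using cont by (auto intro!: continuous_intros)
  have W_pos: "W \<tau> y > 0" for \<tau> y using w by (simp add: W_def)
  have W_per: "W \<tau> (y + T) = W \<tau> y" for \<tau> y by (simp add: W_def per)
  have g_pos: "green T (W \<tau>) x > 0" for \<tau> x by (rule green_pos[OF cW W_pos T])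
  have DG: "((\<lambda>\<tau>. green T (W \<tau>) x) has_real_derivative green T (\<lambda>y. W \<tau> y * h y) x) (at \<tau>)" for \<tau> x
  proof -
    have "((\<lambda>\<tau>. integral (cbox x (x+T)) (\<lambda>y. cos (y - x - T / 2) * W \<tau> y)) has_field_derivative
        integral (cbox x (x+T)) (\<lambda>y. cos (y - x - T / 2) * (W \<tau> y * h y))) (at \<tau> within UNIV)"
    proof (rule leibniz_rule_field_derivative)
      fix \<tau> :: real and y
      show "((\<lambda>\<tau>. cos (y - x - T / 2) * W \<tau> y) has_field_derivative
          cos (y - x - T / 2) * (W \<tau> y * h y)) (at \<tau> within UNIV)"
        unfolding W_def by (auto intro!: derivative_eq_intros)
      show "(\<lambda>y. cos (y - x - T / 2) * W \<tau> y) integrable_on cbox x (x+T)"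
        by (intro integrable_continuous continuous_intros continuous_on_subset[OF cW]) auto
      have "continuous_on A (\<lambda>p. w (snd p))" "continuous_on A (\<lambda>p. h (snd p))" for A :: "(real \<times> real) set"
        using continuous_on_compose2[OF cont(1) continuous_on_snd[OF continuous_on_id]]
          continuous_on_compose2[OF cont(2) continuous_on_snd[OF continuous_on_id]] by auto
      then show "continuous_on (UNIV \<times> cbox x (x + T)) (\<lambda>(\<tau>, y). cos (y - x - T / 2) * (W \<tau> y * h y))"
        unfolding W_def case_prod_unfold by (intro continuous_intros) auto
    qed auto
    from DERIV_cdivide[OF this, of "2 * sin (T / 2)"]
    show ?thesis by (simp add: green_def)
  qed
  define F where "F = (\<lambda>\<tau>. ln (green T (W \<tau>) x) - ln (green T (W \<tau>) x'))"
  define E where "E = (\<lambda>\<tau> x. green T (\<lambda>y. W \<tau> y * h y) x / green T (W \<tau>) x)"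
  have "(F has_real_derivative (E \<tau> x - E \<tau> x')) (at \<tau>)" for \<tau>
    unfolding F_def E_def using g_pos
    by (auto intro!: derivative_eq_intros DG simp: divide_inverse)
  then obtain z where "F 1 - F 0 = (1 - 0) * (E z x - E z x')"
    using MVT2[of 0 1 F "\<lambda>\<tau>. E \<tau> x - E \<tau> x'"] by auto
  moreover have "\<bar>E z x - E z x'\<bar> \<le> (1 - cos (T / 2)) * (M - m)"
    unfolding E_def by (rule green_mean_oscillation[OF cW cont(2) W_per per(2) W_pos h T])
  ultimately have "\<bar>F 1 - F 0\<bar> \<le> (1 - cos (T / 2)) * (M - m)" by simp
  moreover have "F 1 - F 0 = (ln (green T (\<lambda>y. w y * exp (h y)) x) - ln (green T w x)) -
          (ln (green T (\<lambda>y. w y * exp (h y)) x') - ln (green T w x'))"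
    by (simp add: F_def W_def)
  ultimately show ?thesis by simp
qed

section \<open>Exact solutions of period \<open>\<pi> / k\<close>\<close>

text \<open>
  For \<open>s = exp u\<close> this is the logarithm of \<open>green T (f / s\<^sup>3)\<close>.
\<close>

definition log_step :: "real \<Rightarrow> (real \<Rightarrow> real) \<Rightarrow> (real \<Rightarrow> real) \<Rightarrow> real \<Rightarrow> real" where
  "log_step T f u x = ln (green T (\<lambda>y. f y * exp (- 3 * u y)) x)"

context
  fixes f :: "real \<Rightarrow> real" and T :: real
  assumes cont_f: "continuous_on UNIV f" and per_f: "\<And>x. f (x + T) = f x"
    and f_pos: "\<And>x. f x > 0" and T: "0 < T" "T < pi"
begin

lemma log_step_weight:
  assumes "continuous_on UNIV u" "\<And>x. u (x + T) = u x"
  shows "continuous_on UNIV (\<lambda>y. f y * exp (- 3 * u y))"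
    "f (x + T) * exp (- 3 * u (x + T)) = f x * exp (- 3 * u x)"
    "f x * exp (- 3 * u x) > 0"
  using assms cont_f per_f f_pos by (auto intro!: continuous_intros)

lemma log_step_continuous:
  assumes u: "continuous_on UNIV u" "\<And>x. u (x + T) = u x"
  shows "continuous_on UNIV (log_step T f u)"
proof -
  have "continuous_on UNIV (green T (\<lambda>y. f y * exp (- 3 * u y)))"
    using green_continuous[OF log_step_weight(1,2)[OF u]] T by simp
  moreover have "green T (\<lambda>y. f y * exp (- 3 * u y)) x > 0" for x
    by (rule green_pos[OF log_step_weight(1,3)[OF u] T])
  ultimately show ?thesis
    unfolding log_step_def by (intro continuous_on_ln) (auto simp: less_le)
qed

lemma log_step_periodic:
  assumes "\<And>x. u (x + T) = u x"
  shows "log_step T f u (x + T) = log_step T f u x"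
  unfolding log_step_def by (subst green_periodic) (simp_all add: assms per_f)

text \<open>
  The weights of \<open>u\<close> and \<open>v\<close> differ by the factor \<open>exp h\<close> with \<open>h = - 3 (u - v)\<close>; this is where the factor
  \<open>3\<close> enters.
\<close>

lemma log_step_oscillation:
  assumes u: "continuous_on UNIV u" "\<And>x. u (x + T) = u x"
    and v: "continuous_on UNIV v" "\<And>x. v (x + T) = v x"
    and D: "\<And>x y. (u x - v x) - (u y - v y) \<le> D"
  shows "\<bar>(log_step T f u x - log_step T f v x) - (log_step T f u x' - log_step T f v x')\<bar>
    \<le> 3 * (1 - cos (T / 2)) * D"
proof -
  define h where "h = (\<lambda>y. - 3 * (u y - v y))"
  have h: "continuous_on UNIV h" "h (x + T) = h x" for x
    unfolding h_def using u v by (auto intro!: continuous_intros)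
  then obtain a where a: "\<forall>x. h a \<le> h x" using periodic_attains_inf[of h T] T by auto
  have M: "h x \<le> h a + 3 * D" for x using D[of a x] by (simp add: h_def)
  have fu: "f y * exp (- 3 * u y) = f y * exp (- 3 * v y) * exp (h y)" for y
    by (simp add: h_def mult.assoc flip: exp_add)
  have bound: "(1 - cos (T / 2)) * (h a + 3 * D - h a) = 3 * (1 - cos (T / 2)) * D" by simp
  show ?thesis
    using green_ln_oscillation[OF log_step_weight(1)[OF v] h(1) log_step_weight(2)[OF v] h(2) log_step_weight(3)[OF v]
        spec[OF a] M T, of x x']
    unfolding log_step_def fu bound .
qed

text \<open>
  Only oscillations contract, so the iterates are normalized to vanish at \<open>0\<close>.  Then oscillation controls
  the supremum norm and the iterates converge uniformly.
\<close>

lemma log_step_fixed_point: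
  assumes contr: "3 * (1 - cos (T / 2)) < 1"
  shows "\<exists>u. continuous_on UNIV u \<and> (\<forall>x. u (x + T) = u x) \<and>
             (\<forall>x. u x = log_step T f u x - log_step T f u 0)"
proof -
  define \<beta> where "\<beta> = 3 * (1 - cos (T / 2))"
  have \<beta>: "0 \<le> \<beta>" "\<beta> < 1" using contr cos_le_one[of "T / 2"] by (auto simp: \<beta>_def)
  define u where "u = rec_nat (\<lambda>_. 0) (\<lambda>_ v x. log_step T f v x - log_step T f v 0)"
  have u0: "u 0 = (\<lambda>_. 0)" by (simp add: u_def)
  have uS: "u (Suc n) = (\<lambda>x. log_step T f (u n) x - log_step T f (u n) 0)" for n
    by (simp add: u_def)
  have u: "continuous_on UNIV (u n) \<and> (\<forall>x. u n (x + T) = u n x)" for n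
    by (induction n)
      (auto simp: u0 uS log_step_periodic intro!: continuous_intros log_step_continuous)
  then have uc: "continuous_on UNIV (u n)" and up: "u n (x + T) = u n x" for n x by auto
  have u_0: "u n 0 = 0" for n by (cases n) (simp_all add: u0 uS)
  obtain B where B: "B > 0" "\<forall>x. \<bar>u 1 x\<bar> \<le> B"
    using periodic_bounded[of "u 1" T] uc up T by auto
  have osc: "(u (Suc n) x - u n x) - (u (Suc n) y - u n y) \<le> \<beta> ^ n * (2 * B)" for n x y
  proof (induction n arbitrary: x y)
    case 0
    show ?case using spec[OF B(2), of x] spec[OF B(2), of y] by (simp add: u0 abs_le_iff)
  next
    case (Suc n)
    have "\<bar>(log_step T f (u (Suc n)) x - log_step T f (u n) x) -
        (log_step T f (u (Suc n)) y - log_step T f (u n) y)\<bar> \<le> \<beta> * (\<beta> ^ n * (2 * B))"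
      unfolding \<beta>_def[symmetric] using log_step_oscillation[OF uc up uc up Suc] by (simp add: \<beta>_def)
    then show ?case by (simp add: uS[of "Suc n"] uS[of n] abs_le_iff algebra_simps)
  qed
  have step: "norm (u (Suc n) x - u n x) \<le> \<beta> ^ n * (2 * B)" for n x
    using osc[of n x 0] osc[of n 0 x] by (simp add: u_0 abs_le_iff)
  define U where "U = (\<lambda>x. \<Sum>n. u (Suc n) x - u n x)"
  have "uniform_limit UNIV (\<lambda>n x. \<Sum>i<n. u (Suc i) x - u i x) U sequentially"
    unfolding U_def
    by (rule Weierstrass_m_test[OF step]) (use \<beta> in \<open>auto intro!: summable_mult2 summable_geometric\<close>)
  moreover have "(\<Sum>i<n. u (Suc i) x - u i x) = u n x" for n x
    using sum_lessThan_telescope[of "\<lambda>i. u i x" n] by (simp add: u0)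
  ultimately have lim: "uniform_limit UNIV u U sequentially" by simp
  have Uc: "continuous_on UNIV U"
    by (rule uniform_limit_theorem[OF _ lim]) (use uc in auto)
  have pw: "(\<lambda>n. u n x) \<longlonglongrightarrow> U x" for x
    by (rule tendsto_uniform_limitI[OF lim]) simp
  have Up: "U (x + T) = U x" for x
    using LIMSEQ_unique[OF pw[of x]] pw[of "x + T"] by (simp add: up)
  have "U x = log_step T f U x - log_step T f U 0" for x
  proof -
    have "(\<lambda>n. u (Suc n) x) \<longlonglongrightarrow> log_step T f U x - log_step T f U 0"
    proof (rule LIMSEQ_I)
      fix e :: real assume "e > 0"
      then obtain N where N: "\<And>n x. n \<ge> N \<Longrightarrow> dist (u n x) (U x) < e / 4"
        using uniform_limitD[OF lim, of "e / 4"] by (auto simp: eventually_sequentially)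
      have "norm (u (Suc n) x - (log_step T f U x - log_step T f U 0)) < e" if "n \<ge> N" for n
      proof -
        have "(u n x - U x) - (u n y - U y) \<le> e / 2" for x y
          using N[OF that, of x] N[OF that, of y] unfolding dist_real_def abs_less_iff by linarith
        from log_step_oscillation[OF uc up Uc Up this, of x 0]
        have "norm (u (Suc n) x - (log_step T f U x - log_step T f U 0)) \<le> \<beta> * (e / 2)"
          by (simp add: uS \<beta>_def algebra_simps)
        also have "\<dots> < e" using \<beta> \<open>e > 0\<close> mult_right_mono[of \<beta> 1 "e/2"] by linarith
        finally show ?thesis .
      qed
      then show "\<exists>no. \<forall>n\<ge>no. norm (u (Suc n) x - (log_step T f U x - log_step T f U 0)) < e" by blast
    qed
    with LIMSEQ_Suc[OF pw[of x]] show ?thesis by (rule LIMSEQ_unique)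
  qed
  then show ?thesis using Uc Up by blast
qed

lemma green_fixed_point:
  assumes contr: "3 * (1 - cos (T / 2)) < 1"
  shows "\<exists>s. continuous_on UNIV s \<and> (\<forall>x. s (x + T) = s x) \<and> (\<forall>x. s x > 0) \<and>
             (\<forall>x. s x = green T (\<lambda>y. f y / s y ^ 3) x)"
proof -
  obtain u where u: "continuous_on UNIV u" "\<And>x. u (x + T) = u x"
      "\<And>x. u x = log_step T f u x - log_step T f u 0"
    using log_step_fixed_point[OF contr] by blast
  define \<kappa> where "\<kappa> = exp (log_step T f u 0)"
  have G: "green T (\<lambda>y. f y * exp (- 3 * u y)) x = \<kappa> * exp (u x)" for x
  proof -
    have "\<kappa> * exp (u x) = exp (log_step T f u x)"
      using u(3)[of x] by (simp add: \<kappa>_def flip: exp_add)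
    then show ?thesis using green_pos[OF log_step_weight(1,3)[OF u(1,2)] T] by (simp add: log_step_def)
  qed
  \<comment> \<open>Scaling by \<open>\<mu>\<close> multiplies the image by \<open>1 / \<mu>\<^sup>3\<close>, so the constant is absorbed when \<open>\<mu>\<^sup>4 = \<kappa>\<close>.\<close>
  define \<mu> where "\<mu> = root 4 \<kappa>"
  have "\<kappa> > 0" by (simp add: \<kappa>_def)
  then have \<mu>: "\<mu> > 0" "\<mu> ^ 4 = \<kappa>" by (simp_all add: \<mu>_def)
  define s where "s = (\<lambda>x. \<mu> * exp (u x))"
  have "f y / s y ^ 3 = inverse (\<mu> ^ 3) * (f y * exp (- 3 * u y))" for y
    using exp_of_nat_mult[of 3 "u y"] \<mu>(1)
    by (simp add: s_def power_mult_distrib exp_minus field_simps)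
  then have "green T (\<lambda>y. f y / s y ^ 3) x = s x" for x
    using \<mu> by (simp only: green_scale G) (simp add: s_def field_simps power4_eq_xxxx power3_eq_cube flip: \<mu>(2))
  moreover have "continuous_on UNIV s" unfolding s_def by (intro continuous_intros u)
  moreover have "s (x + T) = s x" "s x > 0" for x by (simp_all add: s_def u(2) \<mu>)
  ultimately show ?thesis by metis
qed

end

text \<open>
  Here \<open>k \<ge> 2\<close> matters:  it gives \<open>T / 2 \<le> \<pi> / 4\<close>, hence \<open>3 (1 - cos (T / 2)) \<le> 3 (1 - 1 / sqrt 2) < 1\<close>.
\<close>

lemma even_support_of_periodic:
  fixes f :: "real \<Rightarrow> real" and k :: nat
  assumes f: "smooth f" "\<And>x. f x > 0" "\<And>x. f (x + pi / real k) = f x" and k: "k \<ge> 2"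
  shows "\<exists>s. even_support s \<and> (\<forall>x. s x ^ 3 * ((deriv ^^ 2) s x + s x) = f x)"
proof -
  define T where "T = pi / real k"
  have "T \<le> pi / 2" unfolding T_def using k by (intro divide_left_mono) auto
  have T: "0 < T" "T < pi" using k \<open>T \<le> pi / 2\<close> pi_gt_zero by (simp add: T_def, linarith)
  have "sqrt 2 / 2 = cos (pi / 4)" by (simp add: cos_45)
  also have "\<dots> \<le> cos (T / 2)" using T \<open>T \<le> pi / 2\<close> by (intro cos_monotone_0_pi_le) auto
  finally have "sqrt 2 / 2 \<le> cos (T / 2)" .
  moreover have "4 / 3 < sqrt (2::real)" by (rule real_less_rsqrt) (simp add: power2_eq_square)
  ultimately have "2 / 3 < cos (T / 2)" by simp
  then have contr: "3 * (1 - cos (T / 2)) < 1" by (simp add: field_simps)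
  obtain s where s: "continuous_on UNIV s" "\<And>x. s (x + T) = s x" "\<And>x. s x > 0"
      "\<And>x. s x = green T (\<lambda>y. f y / s y ^ 3) x"
    using green_fixed_point[OF smooth_continuous_on[OF f(1)] f(3)[folded T_def] f(2) T contr] by blast
  have s_ne: "s x \<noteq> 0" for x using s(3)[of x] by simp
  have "continuous_on UNIV f" using f(1) by (rule smooth_continuous_on)
  then have g: "continuous_on UNIV (\<lambda>y. f y / s y ^ 3)" "f (x + T) / s (x + T) ^ 3 = f x / s x ^ 3" for x
    using s_ne f(3)[folded T_def] s(2) by (auto intro!: continuous_intros s(1))
  have "green T (\<lambda>y. f y / s y ^ 3) = s" by (rule ext) (rule s(4)[symmetric])
  then obtain D where D: "\<And>x. (s has_real_derivative D x) (at x)"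
      "\<And>x. (D has_real_derivative (f x / s x ^ 3 - s x)) (at x)"
    using green_DERIV[OF g T(1) less_imp_le[OF T(2)]] by metis
  have F: "differentiable_upto n (\<lambda>x. f x / s x ^ 3 - s x)" if "differentiable_upto n s" for n
  proof -
    have "(\<lambda>x. f x / s x ^ 3 - s x) =
        (\<lambda>x. f x * inverse (s x * (s x * s x)) + (- 1) * s x)"
      by (simp add: divide_inverse power3_eq_cube mult.assoc)
    moreover have "s x * (s x * s x) \<noteq> 0" for x using s_ne by simp
    ultimately show ?thesis
      using that f(1) unfolding smooth_iff_differentiable_upto
      by (simp only:) (intro differentiable_upto_add differentiable_upto_mult
        differentiable_upto_inverse differentiable_upto_const, auto)
  qed
  note sm = smooth_second_order[OF D F]
  have "s (x + real_of_int (int k) * T) = s x" for x by (rule periodic_int_shift) (rule s(2))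
  then have even: "s (x + pi) = s x" for x using k by (simp add: T_def)
  have "even_support s"
    by unfold_locales (use sm s(3) even f(2) in auto)
  moreover have "s x ^ 3 * ((deriv ^^ 2) s x + s x) = f x" for x
    using s_ne[of x] by (simp add: sm(2))
  ultimately show ?thesis by blast
qed

section \<open>Approximate solutions from thin ellipses\<close>

text \<open>
  The ellipse with semiaxes \<open>b\<close> and \<open>1\<close>.
\<close>

definition ellipse_support :: "real \<Rightarrow> real \<Rightarrow> real" where
  "ellipse_support b x = sqrt ((sin x)\<^sup>2 + b\<^sup>2 * (cos x)\<^sup>2)"

lemma ellipse_square_pos: "b > 0 \<Longrightarrow> (sin x)\<^sup>2 + b\<^sup>2 * (cos x)\<^sup>2 > (0::real)"
  using sin_cos_squared_add[of x]
  by (cases "sin x = 0") (auto intro: add_pos_nonneg)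

lemma ellipse_support_pos: "b > 0 \<Longrightarrow> ellipse_support b x > 0"
  using ellipse_square_pos by (simp add: ellipse_support_def)

lemma ellipse_support_square: "b > 0 \<Longrightarrow> (ellipse_support b x)\<^sup>2 = (sin x)\<^sup>2 + b\<^sup>2 * (cos x)\<^sup>2"
  by (simp add: ellipse_support_def)

lemma ellipse_support_even: "ellipse_support b (x + pi) = ellipse_support b x"
  by (simp add: ellipse_support_def)

lemma smooth_ellipse_support: "b > 0 \<Longrightarrow> smooth (ellipse_support b)"
  unfolding ellipse_support_def by (intro smooth_intros ellipse_square_pos)

lemma ellipse_support_DERIV:
  assumes b: "b > 0"
  shows "(ellipse_support b has_real_derivative
      (1 - b\<^sup>2) * (sin x * cos x) / ellipse_support b x) (at x)"
    and "((\<lambda>x. (1 - b\<^sup>2) * (sin x * cos x) / ellipse_support b x) has_real_derivative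
      b\<^sup>2 / ellipse_support b x ^ 3 - ellipse_support b x) (at x)"
proof -
  let ?q = "ellipse_support b"
  show D: "(?q has_real_derivative (1 - b\<^sup>2) * (sin x * cos x) / ?q x) (at x)" for x
  proof -
    have Q: "((\<lambda>x. (sin x)\<^sup>2 + b\<^sup>2 * (cos x)\<^sup>2) has_real_derivative (1 - b\<^sup>2) * (sin x * cos x) * 2) (at x)"
      by (auto intro!: derivative_eq_intros simp: algebra_simps)
    have "p * 2 * (inverse q * (1 / 2)) = p / q" for p q :: real by (simp add: inverse_eq_divide)
    note * = this[of "(1 - b\<^sup>2) * (sin x * cos x)"]
    show ?thesis
      unfolding ellipse_support_def
      by (rule DERIV_sqrt_compose[OF Q ellipse_square_pos[OF b], unfolded *])
  qed
  have q: "?q x > 0" by (rule ellipse_support_pos[OF b])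
  have "((\<lambda>x. (1 - b\<^sup>2) * (sin x * cos x) / ?q x) has_real_derivative
     ((1 - b\<^sup>2) * ((cos x)\<^sup>2 - (sin x)\<^sup>2) * ?q x -
       (1 - b\<^sup>2) * (sin x * cos x) * ((1 - b\<^sup>2) * (sin x * cos x) / ?q x)) / (?q x * ?q x)) (at x)"
    using q by (auto intro!: derivative_eq_intros D simp: power2_eq_square algebra_simps)
  moreover have "((1 - b\<^sup>2) * ((cos x)\<^sup>2 - (sin x)\<^sup>2) * ?q x -
       (1 - b\<^sup>2) * (sin x * cos x) * ((1 - b\<^sup>2) * (sin x * cos x) / ?q x)) / (?q x * ?q x)
     = b\<^sup>2 / ?q x ^ 3 - ?q x"
  proof -
    define S where "S = (sin x)\<^sup>2"
    have C: "(cos x)\<^sup>2 = 1 - S" by (simp add: S_def cos_squared_eq)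
    have q2: "(?q x)\<^sup>2 = S + b\<^sup>2 * (1 - S)" using ellipse_support_square[OF b, of x] by (simp add: S_def C)
    have sc: "(sin x * cos x)\<^sup>2 = S * (1 - S)" by (simp add: power_mult_distrib S_def C[unfolded S_def])
    have "((1 - b\<^sup>2) * ((cos x)\<^sup>2 - (sin x)\<^sup>2) * ?q x -
       (1 - b\<^sup>2) * (sin x * cos x) * ((1 - b\<^sup>2) * (sin x * cos x) / ?q x)) / (?q x * ?q x)
      = ((1 - b\<^sup>2) * ((cos x)\<^sup>2 - S) * (?q x)\<^sup>2 - (1 - b\<^sup>2)\<^sup>2 * (sin x * cos x)\<^sup>2) / ?q x ^ 3"
      using q by (simp add: field_simps power2_eq_square power3_eq_cube S_def)
    also have "\<dots> = (b\<^sup>2 - ((?q x)\<^sup>2)\<^sup>2) / ?q x ^ 3"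
      unfolding q2 sc C by (simp add: power2_eq_square algebra_simps)
    also have "\<dots> = b\<^sup>2 / ?q x ^ 3 - ?q x"
      using q by (simp add: field_simps power2_eq_square power3_eq_cube)
    finally show ?thesis .
  qed
  ultimately show "((\<lambda>x. (1 - b\<^sup>2) * (sin x * cos x) / ?q x) has_real_derivative
      b\<^sup>2 / ?q x ^ 3 - ?q x) (at x)" by simp
qed

lemma abs_sin_le_ellipse_support: "\<bar>sin x\<bar> \<le> ellipse_support b x"
  unfolding ellipse_support_def by (intro real_le_rsqrt) simp

lemma ellipse_support_mono:
  assumes "0 < b" "b \<le> d"
  shows "ellipse_support b x \<le> ellipse_support d x"
  unfolding ellipse_support_def
  using assms by (intro real_sqrt_le_mono add_left_mono mult_right_mono power_mono) auto

lemma ellipse_support_le: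
  assumes "0 < d"
  shows "ellipse_support d x \<le> \<bar>sin x\<bar> + d"
proof -
  have "(sin x)\<^sup>2 + d\<^sup>2 * (cos x)\<^sup>2 \<le> (sin x)\<^sup>2 + d\<^sup>2 * 1"
    using abs_cos_le_one[of x] by (intro add_left_mono mult_left_mono) (auto simp: abs_square_le_1)
  also have "\<dots> \<le> (\<bar>sin x\<bar> + d)\<^sup>2" using assms by (simp add: power2_sum)
  finally show ?thesis unfolding ellipse_support_def using assms by (intro real_le_lsqrt) auto
qed

lemma ellipse_support_ge:
  assumes "0 < b" "b \<le> 1"
  shows "b \<le> ellipse_support b x"
  unfolding ellipse_support_def
proof (rule real_le_rsqrt)
  have "b\<^sup>2 = b\<^sup>2 * (sin x)\<^sup>2 + b\<^sup>2 * (cos x)\<^sup>2" by (simp flip: distrib_left)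
  also have "b\<^sup>2 * (sin x)\<^sup>2 \<le> 1 * (sin x)\<^sup>2"
    using assms by (intro mult_right_mono) (auto simp: power_le_one)
  finally show "b\<^sup>2 \<le> (sin x)\<^sup>2 + b\<^sup>2 * (cos x)\<^sup>2" by simp
qed

lemma abs_le_2_abs_sin:
  assumes "\<bar>x\<bar> \<le> pi / 2"
  shows "\<bar>x\<bar> \<le> 2 * \<bar>sin x\<bar>"
proof -
  have *: "t * cos t \<le> sin t" if "0 \<le> t" "t \<le> pi" for t :: real
  proof -
    have "sin 0 - 0 * cos 0 \<le> sin t - t * cos t"
    proof (rule DERIV_nonneg_imp_nondecreasing[OF that(1)])
      fix x :: real assume x: "0 \<le> x" "x \<le> t"
      have "((\<lambda>x. sin x - x * cos x) has_real_derivative x * sin x) (at x)"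
        by (auto intro!: derivative_eq_intros)
      moreover have "0 \<le> x * sin x" using x that by (intro mult_nonneg_nonneg sin_ge_zero) auto
      ultimately show "\<exists>y. ((\<lambda>x. sin x - x * cos x) has_real_derivative y) (at x) \<and> 0 \<le> y" by blast
    qed
    then show ?thesis by simp
  qed
  have pos: "x \<le> 2 * sin x" if "0 \<le> x" "x \<le> pi / 2" for x :: real
  proof -
    have "x / 2 * cos (x / 2) * cos (x / 2) \<le> sin (x / 2) * cos (x / 2)"
      using that *[of "x / 2"] cos_ge_zero[of "x / 2"] by (intro mult_right_mono) auto
    then have "x * (2 * (cos (x / 2))\<^sup>2) \<le> 2 * (2 * sin (x / 2) * cos (x / 2))"
      by (simp add: power2_eq_square mult_ac)
    then have "x * (1 + cos x) \<le> 2 * sin x"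
      using sin_double[of "x / 2"] cos_double_cos[of "x / 2"] by simp
    moreover have "0 \<le> x * cos x" using that by (intro mult_nonneg_nonneg cos_ge_zero) auto
    ultimately show ?thesis by (simp add: distrib_left)
  qed
  show ?thesis using pos[of x] pos[of "- x"] assms by (cases "0 \<le> x") (auto simp: abs_le_iff)
qed

text \<open>
  A Lipschitz bound near the zeros of the sine, all of which are translates of \<open>0\<close> by a multiple of the
  period.
\<close>

lemma even_smooth_dist_le_sin:
  assumes f: "smooth f" "\<And>x. f (x + pi) = f x"
  shows "\<exists>L\<ge>0. \<forall>x. \<bar>f x - f 0\<bar> \<le> L * \<bar>sin x\<bar>"
proof -
  obtain B where B: "B > 0" "\<forall>x. \<bar>deriv f x\<bar> \<le> B"
    using periodic_bounded[OF smooth_continuous_on[OF smooth_deriv[OF f(1)]] deriv_periodic[of f pi, OF f(2)]]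
    by auto
  have lip: "\<bar>f x - f 0\<bar> \<le> B * \<bar>x\<bar>" for x
    using field_differentiable_bound[of UNIV f "deriv f" B x 0] smooth_DERIV[OF f(1)] B
    by (auto intro: has_field_derivative_at_within)
  have "\<bar>f x - f 0\<bar> \<le> 2 * B * \<bar>sin x\<bar>" for x
  proof -
    obtain n where n: "x + real_of_int n * pi \<in> {-(pi/2)..-(pi/2)+pi}"
      using periodic_reduce[OF pi_gt_zero] by blast
    define y where "y = x + real_of_int n * pi"
    have "f y = f x" "\<bar>sin y\<bar> = \<bar>sin x\<bar>"
      unfolding y_def
      by (rule periodic_int_shift[of f pi], rule f(2))
        (rule periodic_int_shift[of "\<lambda>x. \<bar>sin x\<bar>" pi], simp)
    moreover have "\<bar>y\<bar> \<le> 2 * \<bar>sin y\<bar>"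
      using n unfolding y_def atLeastAtMost_iff
      by (intro abs_le_2_abs_sin) (unfold abs_le_iff, linarith)
    moreover have "B * \<bar>y\<bar> \<le> B * (2 * \<bar>sin y\<bar>)"
      using B(1) calculation(3) by (intro mult_left_mono) auto
    ultimately show ?thesis using lip[of y] by (simp add: mult_ac)
  qed
  then show ?thesis using B(1) by (intro exI[of _ "2 * B"]) auto
qed

lemma cube_perturbation:
  fixes z :: real
  assumes "\<bar>z\<bar> \<le> 1"
  shows "\<bar>(1 + z) ^ 3 - 1\<bar> \<le> 7 * \<bar>z\<bar>"
proof -
  have "(1 + z) ^ 3 - 1 = z * (3 + z * 3 + z * z)" by (simp add: power3_eq_cube algebra_simps)
  moreover have "\<bar>3 + z * 3 + z * z\<bar> \<le> 7"
    using assms mult_mono[of "\<bar>z\<bar>" 1 "\<bar>z\<bar>" 1] by (simp add: abs_le_iff flip: abs_mult)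
  ultimately show ?thesis
    using mult_left_mono[of "\<bar>3 + z * 3 + z * z\<bar>" 7 "\<bar>z\<bar>"] by (simp add: abs_mult)
qed

text \<open>
  The parameters are chosen one after the other:  first \<open>d\<close>, so that \<open>X = f 0 + (f - f 0) (q\<^sub>b / q\<^sub>d)\<^sup>3\<close> is close
  to \<open>f\<close> for every \<open>b \<le> d\<close>; then a bound \<open>W\<close> for the correction \<open>w\<close>, which depends on \<open>d\<close>; then \<open>b\<close>, which
  makes the relative size \<open>z\<close> of the correction small; and the scale \<open>a\<close>, so that \<open>a\<^sup>4 b\<^sup>2 = f 0\<close>.  With
  these, \<open>s\<^sup>3 (s'' + s) = (1 + z)\<^sup>3 X\<close> exactly.  Since \<open>X\<close> is a convex combination of \<open>f 0\<close> and \<open>f\<close>, it is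
  positive, and so is \<open>s'' + s\<close>.
\<close>

lemma even_support_approximation:
  assumes f: "smooth f" "\<And>x. f x > 0" "\<And>x. f (x + pi) = f x" and "\<epsilon> > 0"
  shows "\<exists>s. even_support s \<and> (\<forall>x. \<bar>s x ^ 3 * ((deriv ^^ 2) s x + s x) - f x\<bar> \<le> \<epsilon>)"
proof -
  define f0 where "f0 = f 0"
  have f0: "f0 > 0" using f(2) by (simp add: f0_def)
  obtain L where L: "L \<ge> 0" "\<forall>x. \<bar>f x - f0\<bar> \<le> L * \<bar>sin x\<bar>"
    using even_smooth_dist_le_sin[OF f(1,3)] by (auto simp: f0_def)
  obtain M where M: "M > 0" "\<forall>x. \<bar>f x\<bar> \<le> M"
    using periodic_bounded[OF smooth_continuous_on[OF f(1)] f(3)] by auto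
  define d where "d = min 1 (\<epsilon> / (6 * (L + 1)))"
  have d: "0 < d" "d \<le> 1" "3 * L * d \<le> \<epsilon> / 2"
  proof -
    show "0 < d" "d \<le> 1" using L(1) \<open>\<epsilon> > 0\<close> by (auto simp: d_def)
    have "6 * (L + 1) * d \<le> 6 * (L + 1) * (\<epsilon> / (6 * (L + 1)))"
      using L(1) by (intro mult_left_mono) (auto simp: d_def)
    also have "\<dots> = \<epsilon>" using L(1) by simp
    finally have "6 * (L + 1) * d \<le> \<epsilon>" .
    then show "3 * L * d \<le> \<epsilon> / 2" using \<open>0 < d\<close> by (simp add: algebra_simps)
  qed
  let ?q = ellipse_support
  note q_pos = ellipse_support_pos
  define \<rho> where "\<rho> = (\<lambda>x. (f x - f0) / ?q d x ^ 3)"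
  have "?q d x ^ 3 \<noteq> 0" for x using q_pos[OF d(1), of x] by simp
  then have \<rho>: "smooth \<rho>"
    unfolding \<rho>_def by (intro smooth_intros f(1) smooth_ellipse_support d(1))
  have \<rho>_per: "\<rho> (x + pi) = \<rho> x" for x by (simp add: \<rho>_def f(3) ellipse_support_even)
  define w where "w = green pi \<rho>"
  obtain w' where w': "\<And>x. (w has_real_derivative w' x) (at x)"
      "\<And>x. (w' has_real_derivative (\<rho> x - w x)) (at x)"
    using green_DERIV[OF smooth_continuous_on[OF \<rho>] \<rho>_per pi_gt_zero] by (auto simp: w_def)
  have w: "smooth w"
  proof (rule smooth_second_order(1)[OF w'])
    fix n assume "differentiable_upto n w"
    then have "differentiable_upto n (\<lambda>x. \<rho> x + (- 1) * w x)"
      using \<rho> unfolding smooth_iff_differentiable_upto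
      by (intro differentiable_upto_add differentiable_upto_mult differentiable_upto_const) auto
    then show "differentiable_upto n (\<lambda>x. \<rho> x - w x)" by simp
  qed
  have w_per: "w (x + pi) = w x" for x unfolding w_def by (rule green_periodic) (rule \<rho>_per)
  obtain W where W: "W > 0" "\<forall>x. \<bar>w x\<bar> \<le> W"
    using periodic_bounded[OF smooth_continuous_on[OF w] w_per] by auto
  define b where "b = min d (min (f0 / (2 * W)) (\<epsilon> * f0 / (14 * M * W)))"
  have b: "0 < b" "b \<le> d" "b \<le> 1" using d f0 W(1) M(1) \<open>\<epsilon> > 0\<close> by (auto simp: b_def)
  have "b * W / f0 \<le> 1 / 2"
  proof -
    have "b * W \<le> f0 / (2 * W) * W" using W(1) by (intro mult_right_mono) (auto simp: b_def)
    then show ?thesis using W(1) f0 by (simp add: field_simps)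
  qed
  have "7 * (b * W / f0) * M \<le> \<epsilon> / 2"
  proof -
    have "b * (W * M * 7) \<le> \<epsilon> * f0 / (14 * M * W) * (W * M * 7)"
      using W(1) M(1) by (intro mult_right_mono) (auto simp: b_def)
    then show ?thesis using W(1) M(1) f0 by (simp add: field_simps)
  qed
  define a where "a = root 4 (f0 / b\<^sup>2)"
  have a: "a > 0" "a ^ 4 = f0 / b\<^sup>2" using f0 b by (simp_all add: a_def)
  define s where "s = (\<lambda>x. a * (?q b x + b\<^sup>2 / f0 * w x))"
  define s' where "s' = (\<lambda>x. a * ((1 - b\<^sup>2) * (sin x * cos x) / ?q b x + b\<^sup>2 / f0 * w' x))"
  define F where "F = (\<lambda>x. a * (b\<^sup>2 / ?q b x ^ 3 - ?q b x + b\<^sup>2 / f0 * (\<rho> x - w x)))"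
  have Ds: "(s has_real_derivative s' x) (at x)" for x
    unfolding s_def s'_def
    by (intro DERIV_cmult DERIV_add ellipse_support_DERIV(1) b(1) w'(1))
  have Ds': "(s' has_real_derivative F x) (at x)" for x
    unfolding F_def s'_def
    by (intro DERIV_cmult DERIV_add ellipse_support_DERIV(2) b(1) w'(2))
  have "deriv s = s'" "deriv s' = F" using Ds Ds' by (auto intro: DERIV_imp_deriv)
  then have s2: "(deriv ^^ 2) s = F" by (simp add: funpow_2_deriv)
  define r where "r = (\<lambda>x. (?q b x / ?q d x) ^ 3)"
  define X where "X = (\<lambda>x. f0 * (1 - r x) + f x * r x)"
  define z where "z = (\<lambda>x. b\<^sup>2 * w x / (f0 * ?q b x))"
  have ratio: "0 < ?q b x / ?q d x" "?q b x / ?q d x \<le> 1" for x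
    using q_pos[OF b(1), of x] q_pos[OF d(1), of x] ellipse_support_mono[OF b(1,2), of x] by auto
  have r: "0 < r x" "r x \<le> 1" for x
    using ratio[of x] by (auto simp: r_def intro!: power_le_one)
  have X: "0 < X x" "X x \<le> M" for x
  proof -
    show "0 < X x"
      using r[of x] f0 f(2)[of x] by (auto simp: X_def intro!: add_nonneg_pos mult_nonneg_nonneg)
    have "f0 * (1 - r x) + f x * r x \<le> M * (1 - r x) + M * r x"
      using r[of x] spec[OF M(2), of x] spec[OF M(2), of 0]
      by (intro add_mono mult_right_mono) (auto simp: f0_def)
    then show "X x \<le> M" by (simp add: X_def algebra_simps)
  qed
  have s_eq: "s x = a * ?q b x * (1 + z x)" for x
    using q_pos[OF b(1), of x] f0 by (simp add: s_def z_def field_simps)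
  have F_eq: "F x + s x = a * b\<^sup>2 / (f0 * ?q b x ^ 3) * X x" for x
  proof -
    have "F x + s x = a * (b\<^sup>2 / ?q b x ^ 3 + b\<^sup>2 / f0 * \<rho> x)"
      by (simp add: F_def s_def algebra_simps diff_divide_distrib)
    also have "\<dots> = a * b\<^sup>2 / (f0 * ?q b x ^ 3) * X x"
      using q_pos[OF b(1), of x] q_pos[OF d(1), of x] f0
      by (simp add: \<rho>_def X_def r_def power_divide field_simps)
    finally show ?thesis .
  qed
  \<comment> \<open>The ellipse contributes at least \<open>b\<close>, while the correction carries the factor \<open>b\<^sup>2\<close>, so a factor \<open>b\<close> remains.\<close>
  have z: "\<bar>z x\<bar> \<le> b * W / f0" for x
  proof -
    have "\<bar>z x\<bar> = b\<^sup>2 * \<bar>w x\<bar> / (f0 * ?q b x)"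
      using q_pos[OF b(1), of x] f0 by (simp add: z_def abs_mult)
    also have "\<dots> \<le> b\<^sup>2 * W / (f0 * b)"
      using ellipse_support_ge[OF b(1,3), of x] W f0 b(1)
      by (intro frac_le mult_left_mono mult_pos_pos mult_nonneg_nonneg) auto
    also have "\<dots> = b * W / f0" using b(1) by (simp add: power2_eq_square)
    finally show ?thesis .
  qed
  have z1: "\<bar>z x\<bar> \<le> 1 / 2" for x using z[of x] \<open>b * W / f0 \<le> 1 / 2\<close> by linarith
  have prod: "s x ^ 3 * (F x + s x) = (1 + z x) ^ 3 * X x" for x
  proof -
    have "s x ^ 3 * (F x + s x) = a ^ 4 * b\<^sup>2 / f0 * ((1 + z x) ^ 3 * X x)"
      using q_pos[OF b(1), of x] f0 unfolding F_eq unfolding s_eq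
      by (simp add: field_simps power_mult_distrib power4_eq_xxxx power3_eq_cube)
    then show ?thesis using a(2) b(1) f0 by simp
  qed
  \<comment> \<open>The deviation of \<open>q\<^sub>b / q\<^sub>d\<close> from \<open>1\<close> is at most \<open>d / q\<^sub>d\<close>, and \<open>\<bar>f - f 0\<bar> \<le> L q\<^sub>d\<close> cancels the denominator.\<close>
  have "\<bar>X x - f x\<bar> \<le> 3 * L * d" for x
  proof -
    let ?t = "?q b x / ?q d x"
    have "1 - t ^ 3 = (1 - t) * (1 + t + t\<^sup>2)" for t :: real
      by (simp add: power3_eq_cube power2_eq_square algebra_simps)
    then have "1 - r x = (1 - ?t) * (1 + ?t + ?t\<^sup>2)" by (simp add: r_def)
    also have "\<dots> \<le> (1 - ?t) * 3"
      using ratio[of x] power_le_one[of ?t 2] by (intro mult_left_mono) auto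
    also have "1 - ?t = (?q d x - ?q b x) / ?q d x"
      using q_pos[OF d(1), of x] by (simp add: field_simps)
    also have "\<dots> \<le> d / ?q d x"
      using abs_sin_le_ellipse_support[of x b] ellipse_support_le[OF d(1), of x] q_pos[OF d(1), of x]
      by (intro divide_right_mono) auto
    finally have r3: "1 - r x \<le> d / ?q d x * 3" by simp
    have "X x - f x = (f0 - f x) * (1 - r x)" by (simp add: X_def algebra_simps)
    then have "\<bar>X x - f x\<bar> = \<bar>f x - f0\<bar> * (1 - r x)" using r[of x] by (simp add: abs_mult abs_minus_commute)
    also have "\<dots> \<le> (L * ?q d x) * (d / ?q d x * 3)"
    proof (rule mult_mono[OF _ r3])
      show "\<bar>f x - f0\<bar> \<le> L * ?q d x"
        using spec[OF L(2), of x] mult_left_mono[OF abs_sin_le_ellipse_support[of x d] L(1)] by linarith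
    qed (use L(1) q_pos[OF d(1), of x] r[of x] in auto)
    also have "\<dots> = 3 * L * d" using q_pos[OF d(1), of x] by simp
    finally show ?thesis .
  qed
  moreover have "\<bar>(1 + z x) ^ 3 * X x - X x\<bar> \<le> \<epsilon> / 2" for x
  proof -
    have "(1 + z x) ^ 3 * X x - X x = ((1 + z x) ^ 3 - 1) * X x"
      by (simp add: left_diff_distrib)
    then have "\<bar>(1 + z x) ^ 3 * X x - X x\<bar> = \<bar>(1 + z x) ^ 3 - 1\<bar> * X x"
      using X(1)[of x] by (simp only: abs_mult abs_of_pos)
    also have "\<dots> \<le> (7 * (b * W / f0)) * M"
    proof (rule mult_mono)
      show "\<bar>(1 + z x) ^ 3 - 1\<bar> \<le> 7 * (b * W / f0)"
        using cube_perturbation[of "z x"] z1[of x] z[of x] by linarith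
    qed (use X[of x] b(1) W(1) f0 in auto)
    finally show ?thesis using \<open>7 * (b * W / f0) * M \<le> \<epsilon> / 2\<close> by linarith
  qed
  ultimately have "\<bar>(1 + z x) ^ 3 * X x - f x\<bar> \<le> \<epsilon>" for x
    using d(3) by (smt (verit, ccfv_SIG) field_sum_of_halves)
  moreover have "even_support s"
  proof
    show "smooth s" unfolding s_def
      by (intro smooth_intros smooth_ellipse_support w b(1))
    fix x
    show "s x > 0" unfolding s_eq
      using a(1) q_pos[OF b(1), of x] z1[of x] by (intro mult_pos_pos) (auto simp: abs_le_iff)
    show "s (x + pi) = s x" by (simp add: s_def ellipse_support_even w_per)
    show "(deriv ^^ 2) s x + s x > 0" unfolding s2 F_eq
      using a(1) b(1) f0 q_pos[OF b(1), of x] X(1)[of x] by simp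
  qed
  ultimately show ?thesis using prod by (auto simp: s2)
qed

section \<open>Existence of the bodies\<close>

lemma abs_diff_le_of_cubes:
  fixes x y m :: real
  assumes "x > 0" "y \<ge> m" "m > 0" "\<bar>x ^ 3 - y ^ 3\<bar> \<le> e * m\<^sup>2"
  shows "\<bar>x - y\<bar> \<le> e"
proof -
  have "x ^ 3 - y ^ 3 = (x - y) * (x * x + x * y + y * y)"
    by (simp add: power3_eq_cube algebra_simps)
  moreover have "m\<^sup>2 \<le> x * x + x * y + y * y"
    using assms mult_mono[of m y m y] by (simp add: power2_eq_square add_nonneg_nonneg add_increasing)
  ultimately have "\<bar>x - y\<bar> * m\<^sup>2 \<le> \<bar>x ^ 3 - y ^ 3\<bar>"
    using assms by (simp add: abs_mult mult_left_mono)
  then have "\<bar>x - y\<bar> * m\<^sup>2 \<le> e * m\<^sup>2" using assms(4) by linarith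
  then show ?thesis using assms(3) by simp
qed

theorem theorem1p1:
  fixes \<Phi> :: "real \<Rightarrow> real"
  assumes periodic: "\<And>\<theta>. \<Phi> (\<theta> + 2 * pi) = \<Phi> \<theta>"
    and positive: "\<And>\<theta>. \<Phi> \<theta> > 0"
    and smooth: "smooth \<Phi>"
    and even: "\<And>\<theta>. \<Phi> (\<theta> + pi) = \<Phi> \<theta>"
  shows "\<exists>K :: nat \<Rightarrow> (real ^ 2) set.
    (\<forall>n. K n \<in> K_sym) \<and>
    (\<lambda>n. SUP \<theta>. \<bar>support_fn (K n) \<theta> / root 3 (boundary_curvature (K n) \<theta>) - \<Phi> \<theta>\<bar>)
      \<longlonglongrightarrow> 0 \<and>
    ((\<exists>k::nat. k \<ge> 2 \<and> (\<forall>\<theta>. \<Phi> (\<theta> + pi / real k) = \<Phi> \<theta>)) \<longrightarrow>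
       bounded (\<Union>n. K n) \<and>
       (\<exists>L\<in>K_sym. Cinf_converges K L \<and>
          (\<forall>\<theta>. support_fn L \<theta> * root 3 ((deriv ^^ 2) (support_fn L) \<theta> + support_fn L \<theta>) = \<Phi> \<theta>)))"
proof (cases "\<exists>k::nat. k \<ge> 2 \<and> (\<forall>\<theta>. \<Phi> (\<theta> + pi / real k) = \<Phi> \<theta>)")
  case True
  then obtain k :: nat where k: "k \<ge> 2" "\<And>\<theta>. \<Phi> (\<theta> + pi / real k) = \<Phi> \<theta>" by blast
  obtain s where s: "even_support s" "\<And>\<theta>. s \<theta> ^ 3 * ((deriv ^^ 2) s \<theta> + s \<theta>) = \<Phi> \<theta> ^ 3"
    using even_support_of_periodic[of "\<lambda>\<theta>. \<Phi> \<theta> ^ 3" k] smooth positive k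
    by (auto intro: smooth_power)
  obtain L where L: "L \<in> K_sym" "support_fn L = s"
      "\<And>\<theta>. boundary_curvature L \<theta> = 1 / ((deriv ^^ 2) s \<theta> + s \<theta>)"
    using exists_body_with_support[OF s(1)] by blast
  have sol: "s \<theta> * root 3 ((deriv ^^ 2) s \<theta> + s \<theta>) = \<Phi> \<theta>" for \<theta>
  proof -
    have "s \<theta> * root 3 ((deriv ^^ 2) s \<theta> + s \<theta>) = root 3 (\<Phi> \<theta> ^ 3)"
      using even_support.s_pos[OF s(1), of \<theta>] by (simp add: real_root_mult real_root_power flip: s(2))
    then show ?thesis using positive[of \<theta>] by (simp add: real_root_power_cancel)
  qed
  have "\<bar>support_fn L \<theta> / root 3 (boundary_curvature L \<theta>) - \<Phi> \<theta>\<bar> = 0" for \<theta>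
    using sol[of \<theta>] by (simp add: L real_root_divide)
  then show ?thesis
    using L(1) sol by (intro exI[of _ "\<lambda>_. L"])
      (auto simp: L(2) Cinf_converges_def uniform_limit_const K_sym_def compact_imp_bounded)
next
  case False
  obtain x0 where x0: "\<forall>\<theta>. \<Phi> x0 \<le> \<Phi> \<theta>"
    using periodic_attains_inf[OF smooth_continuous_on[OF smooth] even] by auto
  define m where "m = \<Phi> x0"
  have m: "m > 0" "\<And>\<theta>. m \<le> \<Phi> \<theta>" using positive x0 by (auto simp: m_def)
  have "\<exists>K\<in>K_sym. \<forall>\<theta>. \<bar>support_fn K \<theta> / root 3 (boundary_curvature K \<theta>) - \<Phi> \<theta>\<bar> \<le> e"
    if e: "e > 0" for e
  proof -
    obtain s where s: "even_support s"
        "\<And>\<theta>. \<bar>s \<theta> ^ 3 * ((deriv ^^ 2) s \<theta> + s \<theta>) - \<Phi> \<theta> ^ 3\<bar> \<le> e * m\<^sup>2"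
      using even_support_approximation[of "\<lambda>\<theta>. \<Phi> \<theta> ^ 3" "e * m\<^sup>2"] smooth positive even m(1) e
      by (auto intro: smooth_power)
    obtain K where K: "K \<in> K_sym" "support_fn K = s"
        "\<And>\<theta>. boundary_curvature K \<theta> = 1 / ((deriv ^^ 2) s \<theta> + s \<theta>)"
      using exists_body_with_support[OF s(1)] by blast
    have "\<bar>support_fn K \<theta> / root 3 (boundary_curvature K \<theta>) - \<Phi> \<theta>\<bar> \<le> e" for \<theta>
    proof -
      let ?R = "(deriv ^^ 2) s \<theta> + s \<theta>"
      have pos: "s \<theta> > 0" "?R > 0"
        using even_support.s_pos[OF s(1)] even_support.radius_pos'[OF s(1)] by auto
      have cube: "(s \<theta> * root 3 ?R) ^ 3 = s \<theta> ^ 3 * ?R"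
        using pos by (simp add: power_mult_distrib)
      have "\<bar>s \<theta> * root 3 ?R - \<Phi> \<theta>\<bar> \<le> e"
      proof (rule abs_diff_le_of_cubes)
        show "0 < s \<theta> * root 3 ?R" using pos by (intro mult_pos_pos real_root_gt_zero) auto
        show "\<bar>(s \<theta> * root 3 ?R) ^ 3 - \<Phi> \<theta> ^ 3\<bar> \<le> e * m\<^sup>2" unfolding cube by (rule s(2))
      qed (use m in auto)
      then show ?thesis by (simp add: K real_root_divide)
    qed
    then show ?thesis using K(1) by blast
  qed
  then have "\<forall>n. \<exists>K\<in>K_sym. \<forall>\<theta>. \<bar>support_fn K \<theta> / root 3 (boundary_curvature K \<theta>) - \<Phi> \<theta>\<bar>
      \<le> inverse (real (Suc n))"
    by simp
  then obtain K where K: "\<And>n. K n \<in> K_sym"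
      "\<And>n \<theta>. \<bar>support_fn (K n) \<theta> / root 3 (boundary_curvature (K n) \<theta>) - \<Phi> \<theta>\<bar> \<le> inverse (real (Suc n))"
    by metis
  have "(\<lambda>n. SUP \<theta>. \<bar>support_fn (K n) \<theta> / root 3 (boundary_curvature (K n) \<theta>) - \<Phi> \<theta>\<bar>) \<longlonglongrightarrow> 0"
  proof (rule tendsto_sandwich[OF _ _ tendsto_const LIMSEQ_inverse_real_of_nat])
    show "\<forall>\<^sub>F n in sequentially. 0 \<le> (SUP \<theta>. \<bar>support_fn (K n) \<theta> / root 3 (boundary_curvature (K n) \<theta>) - \<Phi> \<theta>\<bar>)"
    proof (intro always_eventually allI)
      fix n
      show "0 \<le> (SUP \<theta>. \<bar>support_fn (K n) \<theta> / root 3 (boundary_curvature (K n) \<theta>) - \<Phi> \<theta>\<bar>)"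
        by (rule cSUP_upper2[of _ _ 0]) (use K(2) in \<open>auto intro!: bdd_aboveI2\<close>)
    qed
    show "\<forall>\<^sub>F n in sequentially. (SUP \<theta>. \<bar>support_fn (K n) \<theta> / root 3 (boundary_curvature (K n) \<theta>) - \<Phi> \<theta>\<bar>)
        \<le> inverse (real (Suc n))"
      using K(2) by (intro always_eventually allI cSUP_least) auto
  qed
  then show ?thesis using K(1) False by blast
qed

end
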